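(* Let $n,d\ge 1$ be integers, $p\in(1,\infty)$, let $\Omega\subset\mathbb{R}^n$ be a bounded domain with a Lipschitz boundary and let $u_0\in W^{1,p}(\Omega,\mathbb{R}^d)$. Let $f:\overline{\Omega}\times\mathbb{R}^d\times\mathbb{R}^{nd}\to\mathbb{R}$ be a continuous function satisfying the $p$-growth condition (p-G). Put $F(v)=\int_\Omega f(x,v(x),\nabla v(x))\,dx$ and $\mathcal{W}=u_0+W^{1,p}_0(\Omega,\mathbb{R}^d)$, and assume that there exists $w\in\mathcal{W}$ with $F(w)<\infty$ and that $F(w)>-\infty$ for every $w\in\mathcal{W}$. Let $(u_k)$ be a sequence in $\mathcal{W}$ that is minimizing for $F$ on $\mathcal{W}$, i.e. $F(u_k)\to\inf_{w\in\mathcal{W}}F(w)$. Then $(u_k)$ is bounded in $W^{1,p}(\Omega,\mathbb{R}^d)$.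
   Context: The $p$-growth condition (p-G) for $f:\overline{\Omega}\times\mathbb{R}^d\times\mathbb{R}^{z}\to\mathbb{R}$ (here $z=nd$) means: there exist $q$ with $1\le q<p$, a constant $c_0>0$, a constant $c_1\in\mathbb{R}$ and a function $c_2:\overline{\Omega}\to\mathbb{R}$ with $c_2|_\Omega\in L^1(\Omega)$ such that $$f(x,u,\xi)\ge c_0|\xi|^p+c_1|u|^q+c_2(x)\quad\text{for all }(x,u,\xi)\in\overline{\Omega}\times\mathbb{R}^d\times\mathbb{R}^z.$$ The gradient $\nabla v(x)$ of $v\in W^{1,p}(\Omega,\mathbb{R}^d)$ is regarded as an element of $\mathbb{R}^{nd}$. The functional $F$ may take the value $+\infty$. *)

theory Defs
  imports "HOL-Analysis.Analysis"
begin

text \<open>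
  A function on a set \<open>\<Omega>\<close> is represented by a total function whose values outside \<open>\<Omega>\<close> are
  irrelevant. An element of \<open>W\<^sup>1\<^sup>,\<^sup>p(\<Omega>)\<close> is represented by any of its pointwise representatives; no
  quotient by almost everywhere equality is formed. The matrix type \<open>real ^ 'n ^ 'd\<close> plays the
  role of the Euclidean space of dimension \<open>n d\<close>: its norm is the Euclidean norm of the entries.
\<close>

definition lipschitz_boundary :: "(real ^ 'n) set \<Rightarrow> bool" where
  \<comment> \<open>Near every boundary point, in coordinates whose last axis is the unit vector \<open>e\<close>, the set
      is the part above the graph of a Lipschitz function on the hyperplane orthogonal to \<open>e\<close>.
      The point \<open>y - (y \<bullet> e) *\<^sub>R e\<close> is the projection of \<open>y\<close> to that hyperplane.\<close>
  "lipschitz_boundary \<Omega> \<longleftrightarrow>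
     (\<forall>x \<in> frontier \<Omega>. \<exists>r>0. \<exists>e L \<gamma>. norm e = 1 \<and> L-lipschitz_on {y. y \<bullet> e = 0} \<gamma> \<and>
        \<Omega> \<inter> ball x r = {y \<in> ball x r. \<gamma> (y - (y \<bullet> e) *\<^sub>R e) < y \<bullet> e})"

definition partial_derivative ::
    "'n \<Rightarrow> (real ^ 'n \<Rightarrow> 'b::real_normed_vector) \<Rightarrow> real ^ 'n \<Rightarrow> 'b" where
  "partial_derivative i \<phi> x = frechet_derivative \<phi> (at x) (axis i 1)"

primrec C_k :: "nat \<Rightarrow> (real ^ 'n \<Rightarrow> 'b::real_normed_vector) \<Rightarrow> bool" where
  "C_k 0 \<phi> \<longleftrightarrow> continuous_on UNIV \<phi>"
| "C_k (Suc k) \<phi> \<longleftrightarrow> \<phi> differentiable_on UNIV \<and> (\<forall>i. C_k k (partial_derivative i \<phi>))"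

definition test_functions :: "(real ^ 'n) set \<Rightarrow> (real ^ 'n \<Rightarrow> 'b::real_normed_vector) set" where
  "test_functions \<Omega> =
     {\<phi>. (\<forall>k. C_k k \<phi>) \<and> compact (closure {x. \<phi> x \<noteq> 0}) \<and> closure {x. \<phi> x \<noteq> 0} \<subseteq> \<Omega>}"

definition Lp :: "(real ^ 'n) set \<Rightarrow> real \<Rightarrow> (real ^ 'n \<Rightarrow> 'b::euclidean_space) set" where
  "Lp \<Omega> p = {u \<in> borel_measurable (lebesgue_on \<Omega>). integrable (lebesgue_on \<Omega>) (\<lambda>x. norm (u x) powr p)}"

definition locally_integrable_on ::
    "(real ^ 'n \<Rightarrow> 'b::euclidean_space) \<Rightarrow> (real ^ 'n) set \<Rightarrow> bool" (infixr "locally'_integrable'_on" 46) where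
  "u locally_integrable_on \<Omega> \<longleftrightarrow> (\<forall>K. compact K \<and> K \<subseteq> \<Omega> \<longrightarrow> u absolutely_integrable_on K)"

definition has_weak_gradient ::
    "(real ^ 'n) set \<Rightarrow> (real ^ 'n \<Rightarrow> real ^ 'd) \<Rightarrow> (real ^ 'n \<Rightarrow> real ^ 'n ^ 'd) \<Rightarrow> bool" where
  "has_weak_gradient \<Omega> u G \<longleftrightarrow>
     u locally_integrable_on \<Omega> \<and> G locally_integrable_on \<Omega> \<and>
     (\<forall>\<phi> \<in> test_functions \<Omega>. \<forall>i j.
        (\<integral>x. u x $ j * partial_derivative i \<phi> x \<partial>lebesgue_on \<Omega>) =
        - (\<integral>x. G x $ j $ i * \<phi> x \<partial>lebesgue_on \<Omega>))"

text \<open>A weak gradient on an open set is unique up to almost everywhere equality, so the choice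
  of a representative below does not matter.\<close>

definition weak_gradient ::
    "(real ^ 'n) set \<Rightarrow> (real ^ 'n \<Rightarrow> real ^ 'd) \<Rightarrow> real ^ 'n \<Rightarrow> real ^ 'n ^ 'd" where
  "weak_gradient \<Omega> u = (SOME G. has_weak_gradient \<Omega> u G)"

definition W1p :: "(real ^ 'n) set \<Rightarrow> real \<Rightarrow> (real ^ 'n \<Rightarrow> real ^ 'd) set" where
  "W1p \<Omega> p = {u \<in> Lp \<Omega> p. \<exists>G \<in> Lp \<Omega> p. has_weak_gradient \<Omega> u G}"

definition W1p_norm :: "(real ^ 'n) set \<Rightarrow> real \<Rightarrow> (real ^ 'n \<Rightarrow> real ^ 'd) \<Rightarrow> real" where
  "W1p_norm \<Omega> p u =
     ((\<integral>x. norm (u x) powr p \<partial>lebesgue_on \<Omega>) +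
      (\<integral>x. norm (weak_gradient \<Omega> u x) powr p \<partial>lebesgue_on \<Omega>)) powr (1 / p)"

definition W1p_0 :: "(real ^ 'n) set \<Rightarrow> real \<Rightarrow> (real ^ 'n \<Rightarrow> real ^ 'd) set" where
  \<comment> \<open>the closure of the test functions in \<open>W\<^sup>1\<^sup>,\<^sup>p(\<Omega>)\<close>\<close>
  "W1p_0 \<Omega> p = {u \<in> W1p \<Omega> p. \<exists>\<phi>. (\<forall>k. \<phi> k \<in> test_functions \<Omega>) \<and>
     (\<lambda>k::nat. W1p_norm \<Omega> p (\<lambda>x. \<phi> k x - u x)) \<longlonglongrightarrow> 0}"

definition p_growth ::
    "(real ^ 'n) set \<Rightarrow> real \<Rightarrow> ((real ^ 'n) \<times> (real ^ 'd) \<times> (real ^ 'n ^ 'd) \<Rightarrow> real) \<Rightarrow> bool" where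
  "p_growth \<Omega> p f \<longleftrightarrow>
     (\<exists>q c\<^sub>0 c\<^sub>1 c\<^sub>2. 1 \<le> q \<and> q < p \<and> 0 < c\<^sub>0 \<and> integrable (lebesgue_on \<Omega>) c\<^sub>2 \<and>
        (\<forall>x \<in> closure \<Omega>. \<forall>u \<xi>.
           f (x, u, \<xi>) \<ge> c\<^sub>0 * norm \<xi> powr p + c\<^sub>1 * norm u powr q + c\<^sub>2 x))"

text \<open>The integral with values in the extended reals, for measurable integrands. If both parts
  are infinite, its value is \<open>\<infinity>\<close> by the convention \<open>\<infinity> - \<infinity> = \<infinity>\<close> for \<^typ>\<open>ereal\<close>;
  for the functional below this case is excluded by the \<open>p\<close>-growth condition on bounded sets.\<close>

definition extended_integral :: "'a measure \<Rightarrow> ('a \<Rightarrow> real) \<Rightarrow> ereal" where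
  "extended_integral M g =
     enn2ereal (\<integral>\<^sup>+x. ennreal (g x) \<partial>M) - enn2ereal (\<integral>\<^sup>+x. ennreal (- g x) \<partial>M)"

definition variational_functional ::
    "(real ^ 'n) set \<Rightarrow> ((real ^ 'n) \<times> (real ^ 'd) \<times> (real ^ 'n ^ 'd) \<Rightarrow> real) \<Rightarrow>
     (real ^ 'n \<Rightarrow> real ^ 'd) \<Rightarrow> ereal" where
  "variational_functional \<Omega> f v =
     extended_integral (lebesgue_on \<Omega>) (\<lambda>x. f (x, v x, weak_gradient \<Omega> v x))"

definition affine_W1p_0 ::
    "(real ^ 'n) set \<Rightarrow> real \<Rightarrow> (real ^ 'n \<Rightarrow> real ^ 'd) \<Rightarrow> (real ^ 'n \<Rightarrow> real ^ 'd) set" where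
  "affine_W1p_0 \<Omega> p u\<^sub>0 = {\<lambda>x. u\<^sub>0 x + v x | v. v \<in> W1p_0 \<Omega> p}"

end

theory Submission
  imports Defs
begin

text \<open>
  The sublevel sets \<open>{v \<in> u\<^sub>0 + W\<^sup>1\<^sup>,\<^sup>p\<^sub>0. F v \<le> M}\<close> are bounded in \<open>W\<^sup>1\<^sup>,\<^sup>p\<close>, for every real \<open>M\<close>. This gives
  the theorem: the infimum of \<open>F\<close> is less than \<open>\<infinity>\<close>, so a minimizing sequence is eventually below
  some real \<open>M\<close>, and the finitely many remaining terms have a finite norm each.

  For the boundedness of a sublevel set, write \<open>D\<close> for the integral of \<open>|\<nabla>v|\<^sup>p\<close>. The growth condition bounds
  \<open>c\<^sub>0 D\<close> by \<open>M\<close> plus a constant plus \<open>|c\<^sub>1|\<close> times the integral of \<open>|v|\<^sup>q\<close>. As \<open>q < p\<close> and \<open>\<Omega>\<close> has finite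
  measure, the last integral is at most \<open>\<delta> \<integral>|v|\<^sup>p + K\<close> with \<open>\<delta>\<close> as small as one likes. The Poincare
  inequality bounds \<open>\<integral>|v|\<^sup>p\<close> by \<open>A + B D\<close>, with \<open>A\<close> and \<open>B\<close> depending on \<open>u\<^sub>0\<close>, \<open>p\<close> and \<open>\<Omega>\<close> only. So
  for small \<open>\<delta>\<close> the term is absorbed by \<open>c\<^sub>0 D\<close>, and \<open>D\<close> is bounded (lemma \<open>coercive\<close>).

  The Poincare inequality for a test function \<open>\<phi>\<close> comes from the divergence theorem in its simplest form, by which
  the integral of \<open>\<partial>\<^sub>i g\<close> vanishes if \<open>g\<close> has bounded support. With \<open>g = x\<^sub>i |\<phi>|\<^sup>p\<close> this bounds
  \<open>\<integral>|\<phi>|\<^sup>p\<close> by \<open>p\<close> times the integral of \<open>|x\<^sub>i| |\<phi>|\<^sup>p\<^sup>-\<^sup>1 |\<partial>\<^sub>i \<phi>|\<close>, and Young's inequality absorbs the power of \<open>|\<phi>|\<close>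
  (lemma \<open>poincare_test_functions\<close>). The vanishing of \<open>\<integral>\<partial>\<^sub>i g\<close> follows from the translation
  invariance of Lebesgue measure: difference quotients of \<open>g\<close> have integral zero, and dominated
  convergence passes to the derivative (lemma \<open>has_bochner_integral_directional_derivative\<close>).

  The inequality passes to the closure \<open>W\<^sup>1\<^sup>,\<^sup>p\<^sub>0\<close> and to \<open>u\<^sub>0 + W\<^sup>1\<^sup>,\<^sup>p\<^sub>0\<close> because the weak gradient is additive
  up to null sets and agrees with the classical gradient of a test function. Both facts rest on the
  uniqueness of weak gradients, which is the fundamental lemma of the calculus of variations
  (lemma \<open>fundamental_lemma\<close>); its proof needs smooth functions that approximate the indicator of
  a box.
\<close>

section \<open>Smooth bump functions on boxes\<close>

lemma C_k_SucD: "C_k (Suc k) \<phi> \<Longrightarrow> C_k k \<phi>"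
proof (induction k arbitrary: \<phi>)
  case 0
  then show ?case
    by (simp add: differentiable_imp_continuous_on)
qed auto

lemma C_k_differentiable: "C_k (Suc k) \<phi> \<Longrightarrow> \<phi> differentiable (at x)"
  by (simp add: differentiable_on_def)

lemma C_k_Suc_iff:
  "C_k (Suc k) \<phi> \<longleftrightarrow> (\<forall>x. \<phi> differentiable (at x)) \<and> (\<forall>i. C_k k (partial_derivative i \<phi>))"
  by (simp add: differentiable_on_def)

lemma partial_derivative_eqI:
  assumes "(\<phi> has_derivative D) (at x)"
  shows "partial_derivative i \<phi> x = D (axis i 1)"
  using frechet_derivative_at[OF assms] by (simp add: partial_derivative_def)

lemma C_k_const: "C_k k (\<lambda>x. c)"
proof (induction k arbitrary: c)
  case (Suc k)
  have "partial_derivative i (\<lambda>x::real^'a. c) = (\<lambda>x. 0)" for i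
    by (auto intro!: partial_derivative_eqI[THEN trans] derivative_eq_intros)
  then show ?case
    using Suc by (simp add: C_k_Suc_iff del: C_k.simps)
qed auto

lemma C_k_add:
  assumes "C_k k \<phi>" "C_k k \<psi>"
  shows "C_k k (\<lambda>x. \<phi> x + \<psi> x)"
  using assms
proof (induction k arbitrary: \<phi> \<psi>)
  case 0
  then show ?case by (simp add: continuous_on_add)
next
  case (Suc k)
  have D: "\<phi> differentiable (at x)" "\<psi> differentiable (at x)" for x
    using Suc.prems C_k_differentiable by blast+
  have "partial_derivative i (\<lambda>x. \<phi> x + \<psi> x) =
      (\<lambda>x. partial_derivative i \<phi> x + partial_derivative i \<psi> x)" for i
    by (rule ext, rule partial_derivative_eqI[THEN trans],
        rule has_derivative_add[OF D[unfolded frechet_derivative_works]])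
       (simp add: partial_derivative_def)
  then show ?case
    using Suc D by (simp add: C_k_Suc_iff del: C_k.simps)
qed

lemma C_k_mult:
  fixes \<phi> \<psi> :: "real^'n \<Rightarrow> real"
  assumes "C_k k \<phi>" "C_k k \<psi>"
  shows "C_k k (\<lambda>x. \<phi> x * \<psi> x)"
  using assms
proof (induction k arbitrary: \<phi> \<psi>)
  case 0
  then show ?case by (simp add: continuous_on_mult)
next
  case (Suc k)
  have D: "\<phi> differentiable (at x)" "\<psi> differentiable (at x)" for x
    using Suc.prems C_k_differentiable by blast+
  have "partial_derivative i (\<lambda>x. \<phi> x * \<psi> x) =
      (\<lambda>x. \<phi> x * partial_derivative i \<psi> x + partial_derivative i \<phi> x * \<psi> x)" for i
    by (rule ext, rule partial_derivative_eqI[THEN trans],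
        rule has_derivative_mult[OF D[unfolded frechet_derivative_works]])
       (simp add: partial_derivative_def)
  then show ?case
    using Suc D C_k_SucD[OF Suc.prems(1)] C_k_SucD[OF Suc.prems(2)]
    by (simp add: C_k_Suc_iff C_k_add del: C_k.simps)
qed

lemma C_k_prod:
  fixes \<phi> :: "'i \<Rightarrow> real^'n \<Rightarrow> real"
  assumes "\<And>i. i \<in> I \<Longrightarrow> C_k k (\<phi> i)"
  shows "C_k k (\<lambda>x. \<Prod>i\<in>I. \<phi> i x)"
  using assms by (induction I rule: infinite_finite_induct) (auto simp: C_k_const C_k_mult)

text \<open>
  The powers of \<open>t\<close> in the denominator are those that differentiation of \<open>exp (- 1 / t)\<close> produces.
\<close>

definition flat_exp :: "nat \<Rightarrow> real \<Rightarrow> real" where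
  "flat_exp n t = (if 0 < t then exp (- 1 / t) / t ^ n else 0)"

lemma tendsto_flat_exp_at_right: "(flat_exp n \<longlongrightarrow> 0) (at_right 0)"
proof -
  have "((\<lambda>t. inverse t ^ n / exp (inverse t)) \<longlongrightarrow> (0::real)) (at_right 0)"
    by (rule filterlim_compose[OF tendsto_power_div_exp_0 filterlim_inverse_at_top_right])
  moreover have "\<forall>\<^sub>F t in at_right 0. flat_exp n t = inverse t ^ n / exp (inverse t)"
    by (rule eventually_mono[OF eventually_at_right_less[of "0::real"]])
       (simp add: flat_exp_def exp_minus field_simps)
  ultimately show ?thesis
    by (simp add: tendsto_cong)
qed

lemma flat_exp_has_derivative:
  "(flat_exp n has_field_derivative - real n * flat_exp (Suc n) t + flat_exp (n + 2) t) (at t)"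
proof -
  consider "t < 0" | "t = 0" | "t > 0" by linarith
  then show ?thesis
  proof cases
    case 1
    have "((\<lambda>t. 0) has_field_derivative 0) (at t)" by simp
    then have "(flat_exp n has_field_derivative 0) (at t)"
      by (rule has_field_derivative_transform_within_open[where S="{..<0}"])
         (use 1 in \<open>auto simp: flat_exp_def\<close>)
    then show ?thesis using 1 by (simp add: flat_exp_def)
  next
    case 2
    have "((\<lambda>h. flat_exp n h / h) \<longlongrightarrow> 0) (at_right 0)"
      by (rule Lim_transform_eventually[OF tendsto_flat_exp_at_right[of "Suc n"]])
         (rule eventually_mono[OF eventually_at_right_less[of "0::real"]],
          simp add: flat_exp_def field_simps)
    moreover have "((\<lambda>h. flat_exp n h / h) \<longlongrightarrow> 0) (at_left 0)"
      by (rule Lim_transform_eventually[OF tendsto_const])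
         (rule eventually_mono[OF eventually_at_left_real[of "-1"]], auto simp: flat_exp_def)
    ultimately have "((\<lambda>h. flat_exp n h / h) \<longlongrightarrow> 0) (at 0)"
      by (simp add: filterlim_split_at)
    then show ?thesis
      using 2 by (simp add: DERIV_def flat_exp_def)
  next
    case 3
    have "((\<lambda>t. exp (- 1 / t) / t ^ n) has_field_derivative
        - real n * flat_exp (Suc n) t + flat_exp (n + 2) t) (at t)"
      using 3
      by (cases n, auto intro!: derivative_eq_intros simp: flat_exp_def field_simps power2_eq_square)
         (metis Suc_pred neq0_conv power_Suc)
    then show ?thesis
      by (rule has_field_derivative_transform_within_open[where S="{0<..}"])
         (use 3 in \<open>auto simp: flat_exp_def\<close>)
  qed
qed

text \<open>
  The induction runs over \<open>k\<close> for all \<open>n\<close> at once: a partial derivative of the function for \<open>n\<close> is a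
  combination of the functions for \<open>n + 1\<close> and \<open>n + 2\<close>.
\<close>

lemma C_k_flat_exp_coordinate:
  "C_k k (\<lambda>x::real^'n. flat_exp n (c * x $ i + d))"
proof (induction k arbitrary: n)
  case 0
  have "continuous_on UNIV (flat_exp n)"
    using flat_exp_has_derivative by (meson DERIV_isCont continuous_at_imp_continuous_on)
  then have "continuous_on UNIV (\<lambda>x::real^'n. flat_exp n (c * x $ i + d))"
    by (rule continuous_on_compose2) (auto intro!: continuous_intros)
  then show ?case by simp
next
  case (Suc k)
  let ?\<phi> = "\<lambda>n x::real^'n. flat_exp n (c * x $ i + d)"
  have D: "(?\<phi> n has_derivative
      (\<lambda>h. c * h $ i * (- real n * ?\<phi> (Suc n) x + ?\<phi> (n + 2) x))) (at x)" for x :: "real^'n"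
  proof -
    have "((\<lambda>x::real^'n. c * x $ i + d) has_derivative (\<lambda>h. c * h $ i)) (at x)"
      by (auto intro!: derivative_eq_intros bounded_linear_vec_nth[THEN bounded_linear_imp_has_derivative])
    then show ?thesis
      by (rule has_derivative_compose[OF _ flat_exp_has_derivative[THEN has_field_derivative_imp_has_derivative],
            THEN has_derivative_eq_rhs])
         (simp add: mult_ac fun_eq_iff)
  qed
  have "partial_derivative j (?\<phi> n) =
      (\<lambda>x. c * (if j = i then 1 else 0) * (- real n * ?\<phi> (Suc n) x + ?\<phi> (n + 2) x))" for j
    using partial_derivative_eqI[OF D] by (auto simp: axis_def fun_eq_iff)
  moreover have "C_k k (\<lambda>x. c * (if j = i then 1 else 0) * (- real n * ?\<phi> (Suc n) x + ?\<phi> (n + 2) x))" for j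
    by (intro C_k_mult C_k_add C_k_const Suc)
  ultimately show ?case
    using D unfolding C_k_Suc_iff differentiable_def by auto
qed

text \<open>
  Each factor \<open>flat_exp 0 ((m + 1) t)\<close> tends to the indicator of \<open>t > 0\<close> as \<open>m\<close> grows.
\<close>

definition box_bump :: "real^'n \<Rightarrow> real^'n \<Rightarrow> nat \<Rightarrow> real^'n \<Rightarrow> real" where
  "box_bump a b m x =
     (\<Prod>i\<in>UNIV. flat_exp 0 (real (Suc m) * (x $ i - a $ i)) * flat_exp 0 (real (Suc m) * (b $ i - x $ i)))"

lemma C_k_box_bump: "C_k k (box_bump a b m)"
proof -
  have "C_k k (\<lambda>x. flat_exp 0 (real (Suc m) * x $ i + (- real (Suc m) * a $ i)) *
            flat_exp 0 (- real (Suc m) * x $ i + real (Suc m) * b $ i))" for i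
    by (intro C_k_mult C_k_flat_exp_coordinate)
  then have "C_k k (\<lambda>x. \<Prod>i\<in>UNIV. flat_exp 0 (real (Suc m) * x $ i + (- real (Suc m) * a $ i)) *
            flat_exp 0 (- real (Suc m) * x $ i + real (Suc m) * b $ i))"
    by (intro C_k_prod) 
  then show ?thesis
    by (simp add: box_bump_def[abs_def] algebra_simps)
qed

lemma flat_exp_0_bounds: "0 \<le> flat_exp 0 t" "flat_exp 0 t \<le> 1"
  by (auto simp: flat_exp_def)

lemma box_bump_bounds: "0 \<le> box_bump a b m x" "box_bump a b m x \<le> 1"
  unfolding box_bump_def
  by (auto intro!: prod_nonneg prod_le_1 mult_le_one simp: flat_exp_0_bounds)

lemma box_bump_outside:
  assumes "x \<notin> box a b"
  shows "box_bump a b m x = 0"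
proof -
  obtain i where "x $ i \<le> a $ i \<or> b $ i \<le> x $ i"
    using assms by (auto simp: mem_box_cart not_less)
  then have "flat_exp 0 (real (Suc m) * (x $ i - a $ i)) * flat_exp 0 (real (Suc m) * (b $ i - x $ i)) = 0"
    by (auto simp: flat_exp_def zero_less_mult_iff)
  then show ?thesis
    unfolding box_bump_def by (metis (no_types, lifting) UNIV_I finite_class.finite_UNIV prod_zero_iff)
qed

lemma tendsto_box_bump:
  fixes a :: "real^'a"
  shows "(\<lambda>m. box_bump a b m x) \<longlonglongrightarrow> indicator (box a b) x"
proof (cases "x \<in> box a b")
  case True
  have *: "(\<lambda>m. flat_exp 0 (real (Suc m) * s)) \<longlonglongrightarrow> 1" if "s > 0" for s :: real
  proof -
    have "(\<lambda>m. (- 1 / s) * inverse (real (Suc m))) \<longlonglongrightarrow> (- 1 / s) * 0"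
      by (intro tendsto_mult tendsto_const LIMSEQ_inverse_real_of_nat)
    then have "(\<lambda>m. exp ((- 1 / s) * inverse (real (Suc m)))) \<longlonglongrightarrow> 1"
      using tendsto_exp by fastforce
    moreover have "flat_exp 0 (real (Suc m) * s) = exp ((- 1 / s) * inverse (real (Suc m)))" for m
      using that by (simp add: flat_exp_def inverse_eq_divide mult.commute)
    ultimately show ?thesis by simp
  qed
  have "(\<lambda>m. box_bump a b m x) \<longlonglongrightarrow> (\<Prod>i\<in>(UNIV :: 'a set). 1 * 1)"
    unfolding box_bump_def using True
    by (intro tendsto_prod tendsto_mult *) (auto simp: mem_box_cart)
  then show ?thesis using True by simp
qed (simp add: box_bump_outside)

lemma box_bump_in_test_functions:
  assumes "cbox a b \<subseteq> \<Omega>"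
  shows "box_bump a b m \<in> test_functions \<Omega>"
proof -
  have "{x. box_bump a b m x \<noteq> 0} \<subseteq> cbox a b"
    using box_bump_outside box_subset_cbox by blast
  then have "closure {x. box_bump a b m x \<noteq> 0} \<subseteq> cbox a b"
    by (rule closure_minimal) (rule closed_cbox)
  then show ?thesis
    using assms C_k_box_bump unfolding test_functions_def
    by (auto simp: compact_eq_bounded_closed intro: bounded_subset[OF bounded_cbox])
qed

section \<open>The fundamental lemma and uniqueness of weak gradients\<close>

lemma locally_integrable_on_bounded_linear:
  fixes T :: "'b::euclidean_space \<Rightarrow> 'c::euclidean_space"
  assumes "bounded_linear T" "u locally_integrable_on \<Omega>"
  shows "(\<lambda>x. T (u x)) locally_integrable_on \<Omega>"
  using assms absolutely_integrable_linear unfolding locally_integrable_on_def comp_def by blast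

lemma locally_integrable_on_add_scaleR:
  assumes "u locally_integrable_on \<Omega>" "v locally_integrable_on \<Omega>"
  shows "(\<lambda>x. u x + c *\<^sub>R v x) locally_integrable_on \<Omega>"
  using assms unfolding locally_integrable_on_def
  by (auto intro!: set_integral_add absolutely_integrable_scaleR_left)

text \<open>
  Local integrability speaks about compact subsets only; an open set is a countable union of closed
  boxes, and measurability can be checked on each of them.
\<close>

lemma locally_integrable_on_imp_measurable:
  assumes "open \<Omega>" "u locally_integrable_on \<Omega>"
  shows "u \<in> borel_measurable (lebesgue_on \<Omega>)"
proof -
  obtain \<D> where \<D>: "countable \<D>" "\<D> \<subseteq> Pow \<Omega>" "\<And>X. X \<in> \<D> \<Longrightarrow> \<exists>a b. X = cbox a b" "\<Union>\<D> = \<Omega>"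
    using open_countable_Union_open_cbox[OF \<open>open \<Omega>\<close>] by blast
  show ?thesis
  proof (rule measurable_piecewise_restrict[where C=\<D>])
    fix K assume "K \<in> \<D>"
    with \<D> obtain a b where K: "K = cbox a b" "K \<subseteq> \<Omega>" by blast
    then have "K \<inter> \<Omega> = K" by blast
    moreover have \<Omega>: "\<Omega> \<in> sets lebesgue" using \<open>open \<Omega>\<close> by (simp add: borel_open)
    ultimately show "K \<inter> space (lebesgue_on \<Omega>) \<in> sets (lebesgue_on \<Omega>)"
      using K by (auto simp: sets_restrict_space_iff)
    have "u absolutely_integrable_on K"
      using assms K by (auto simp: locally_integrable_on_def)
    then have "u \<in> borel_measurable (lebesgue_on K)"
      using absolutely_integrable_measurable[of K u] K by simp
    then show "u \<in> restrict_space (lebesgue_on \<Omega>) K \<rightarrow>\<^sub>M borel"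
      using \<open>K \<inter> \<Omega> = K\<close> \<Omega> K by (simp add: restrict_restrict_space Int_commute)
  qed (use \<D> in auto)
qed

lemma
  fixes f :: "real^'n \<Rightarrow> 'b::euclidean_space"
  assumes "\<Omega> \<in> sets lebesgue" "\<And>x. x \<notin> \<Omega> \<Longrightarrow> f x = 0"
  shows integrable_lebesgue_on_supported: "integrable (lebesgue_on \<Omega>) f \<longleftrightarrow> integrable lebesgue f"
    and integral_lebesgue_on_supported: "integral\<^sup>L (lebesgue_on \<Omega>) f = integral\<^sup>L lebesgue f"
proof -
  have "indicator \<Omega> x *\<^sub>R f x = f x" for x
    using assms(2) by (cases "x \<in> \<Omega>") auto
  then show "integrable (lebesgue_on \<Omega>) f \<longleftrightarrow> integrable lebesgue f"
    "integral\<^sup>L (lebesgue_on \<Omega>) f = integral\<^sup>L lebesgue f"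
    using assms(1) by (simp_all add: integrable_restrict_space integral_restrict_space)
qed

lemma integrable_mult_compact_support:
  fixes H g :: "real^'n \<Rightarrow> real"
  assumes "H absolutely_integrable_on K" "compact K" "continuous_on UNIV g" "\<And>x. x \<notin> K \<Longrightarrow> g x = 0"
  shows "integrable lebesgue (\<lambda>x. H x * g x)"
proof -
  have K: "K \<in> sets lebesgue" using \<open>compact K\<close> by (simp add: lmeasurable_compact fmeasurableD)
  have g: "continuous_on K g" using assms continuous_on_subset by blast
  then have "(\<lambda>x. g x * H x) absolutely_integrable_on K"
    using assms K
    by (intro absolutely_integrable_bounded_measurable_product[OF bilinear_times])
       (auto intro: continuous_imp_measurable_on_sets_lebesgue compact_imp_bounded compact_continuous_image)
  moreover have "(\<lambda>x. indicator K x *\<^sub>R (g x * H x)) = (\<lambda>x. H x * g x)"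
  proof
    show "indicator K x *\<^sub>R (g x * H x) = H x * g x" for x
      using assms(4)[of x] by (cases "x \<in> K") auto
  qed
  ultimately show ?thesis
    unfolding set_integrable_def by metis
qed

lemma partial_derivative_outside_support:
  assumes "x \<notin> closure {x. \<phi> x \<noteq> 0}"
  shows "partial_derivative i \<phi> x = 0"
proof -
  have "(\<phi> has_derivative (\<lambda>_. 0)) (at x)"
    by (rule has_derivative_transform_within_open[OF has_derivative_const[of 0 "at x"],
          of "- closure {x. \<phi> x \<noteq> 0}"])
       (use assms closure_subset[of "{x. \<phi> x \<noteq> 0}"] in \<open>auto simp: open_Compl\<close>)
  then show ?thesis by (rule partial_derivative_eqI)
qed

lemma test_functionsD:
  assumes "\<phi> \<in> test_functions \<Omega>"
  shows "compact (closure {x. \<phi> x \<noteq> 0})" "closure {x. \<phi> x \<noteq> 0} \<subseteq> \<Omega>"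
    "continuous_on UNIV \<phi>" "\<And>x. \<phi> differentiable (at x)"
    "\<And>i. continuous_on UNIV (partial_derivative i \<phi>)"
    "\<And>x. x \<notin> closure {x. \<phi> x \<noteq> 0} \<Longrightarrow> \<phi> x = 0"
proof -
  have C: "C_k k \<phi>" for k using assms by (auto simp: test_functions_def)
  show "continuous_on UNIV \<phi>" using C[of 0] by simp
  show "\<phi> differentiable (at x)" for x using C by (rule C_k_differentiable)
  show "continuous_on UNIV (partial_derivative i \<phi>)" for i
    using C[of "Suc 0"] by simp
qed (use assms closure_subset[of "{x. \<phi> x \<noteq> 0}"] in \<open>auto simp: test_functions_def\<close>)

lemma
  fixes H \<phi> :: "real^'n \<Rightarrow> real"
  assumes "open \<Omega>" "H locally_integrable_on \<Omega>" "\<phi> \<in> test_functions \<Omega>"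
  shows integrable_mult_test_function: "integrable (lebesgue_on \<Omega>) (\<lambda>x. H x * \<phi> x)"
    and integrable_mult_partial_test_function:
      "integrable (lebesgue_on \<Omega>) (\<lambda>x. H x * partial_derivative i \<phi> x)"
proof -
  let ?K = "closure {x. \<phi> x \<noteq> 0}"
  note \<phi> = test_functionsD[OF assms(3)]
  have H: "H absolutely_integrable_on ?K"
    using assms(2) \<phi>(1,2) unfolding locally_integrable_on_def by blast
  have \<Omega>: "\<Omega> \<in> sets lebesgue" using \<open>open \<Omega>\<close> by (simp add: borel_open)
  have out: "H x * \<phi> x = 0" "H x * partial_derivative i \<phi> x = 0" if "x \<notin> \<Omega>" for x
  proof -
    have x: "x \<notin> ?K" using that \<phi>(2) by blast
    show "H x * \<phi> x = 0" "H x * partial_derivative i \<phi> x = 0"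
      using \<phi>(6)[OF x] partial_derivative_outside_support[OF x] by simp_all
  qed
  have "integrable lebesgue (\<lambda>x. H x * \<phi> x)"
    by (rule integrable_mult_compact_support[OF H \<phi>(1) \<phi>(3) \<phi>(6)])
  then show "integrable (lebesgue_on \<Omega>) (\<lambda>x. H x * \<phi> x)"
    using integrable_lebesgue_on_supported[OF \<Omega> out(1)] by simp
  have "integrable lebesgue (\<lambda>x. H x * partial_derivative i \<phi> x)"
    by (rule integrable_mult_compact_support[OF H \<phi>(1) \<phi>(5) partial_derivative_outside_support])
  then show "integrable (lebesgue_on \<Omega>) (\<lambda>x. H x * partial_derivative i \<phi> x)"
    using integrable_lebesgue_on_supported[OF \<Omega> out(2)] by simp
qed

text \<open>
  The bump functions converge to the indicator of the open box and are bounded by the indicator of the closed one,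
  on which \<open>H\<close> is integrable; dominated convergence applies.
\<close>

lemma integral_box_eq_0:
  fixes H :: "real^'n \<Rightarrow> real"
  assumes "open \<Omega>" "H locally_integrable_on \<Omega>"
    and test: "\<And>\<phi>. \<phi> \<in> test_functions \<Omega> \<Longrightarrow> (\<integral>x. H x * \<phi> x \<partial>lebesgue_on \<Omega>) = 0"
    and ab: "cbox a b \<subseteq> \<Omega>"
  shows "integral (cbox a b) H = 0"
proof -
  have \<Omega>: "\<Omega> \<in> sets lebesgue" using \<open>open \<Omega>\<close> by (simp add: borel_open)
  have H: "H absolutely_integrable_on cbox a b"
    using assms by (auto simp: locally_integrable_on_def)
  have Hb: "H absolutely_integrable_on box a b"
    using set_integrable_subset[OF H, of "box a b"] box_subset_cbox by auto
  have out: "H x * box_bump a b m x = 0" if "x \<notin> \<Omega>" for x m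
    using that ab box_subset_cbox box_bump_outside by (metis mult_zero_right subsetD)
  have s: "integrable lebesgue (\<lambda>x. H x * box_bump a b m x)" for m
    using integrable_mult_test_function[OF assms(1,2) box_bump_in_test_functions[OF ab], of m]
      integrable_lebesgue_on_supported[of \<Omega> "\<lambda>x. H x * box_bump a b m x", OF \<Omega> out] by simp
  have "(\<lambda>m. \<integral>x. H x * box_bump a b m x \<partial>lebesgue) \<longlonglongrightarrow> (\<integral>x. H x * indicator (box a b) x \<partial>lebesgue)"
  proof (rule integral_dominated_convergence)
    show "(\<lambda>x. H x * indicator (box a b) x) \<in> borel_measurable lebesgue"
      using Hb by (auto simp: set_integrable_def mult.commute)
    show "(\<lambda>x. H x * box_bump a b m x) \<in> borel_measurable lebesgue" for m
      using s by blast
    show "integrable lebesgue (\<lambda>x. norm (indicator (cbox a b) x *\<^sub>R H x))"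
      using H by (simp add: set_integrable_def integrable_norm)
    show "AE x in lebesgue. (\<lambda>m. H x * box_bump a b m x) \<longlonglongrightarrow> H x * indicator (box a b) x"
      by (intro AE_I2 tendsto_mult tendsto_const tendsto_box_bump)
    show "AE x in lebesgue. norm (H x * box_bump a b m x) \<le> norm (indicator (cbox a b) x *\<^sub>R H x)" for m
    proof (rule AE_I2)
      fix x
      have "\<bar>H x\<bar> * \<bar>box_bump a b m x\<bar> \<le> \<bar>H x\<bar> * 1"
        by (intro mult_left_mono) (use box_bump_bounds[of a b m x] in auto)
      moreover have "box_bump a b m x = 0" if "x \<notin> cbox a b"
        using that box_subset_cbox by (intro box_bump_outside) blast
      ultimately show "norm (H x * box_bump a b m x) \<le> norm (indicator (cbox a b) x *\<^sub>R H x)"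
        by (cases "x \<in> cbox a b") (auto simp: abs_mult)
    qed
  qed
  moreover have "(\<integral>x. H x * box_bump a b m x \<partial>lebesgue) = 0" for m
    using test[OF box_bump_in_test_functions[OF ab]] integral_lebesgue_on_supported[of \<Omega> "\<lambda>x. H x * box_bump a b m x", OF \<Omega> out] by simp
  ultimately have "(\<integral>x. H x * indicator (box a b) x \<partial>lebesgue) = 0"
    using LIMSEQ_unique[OF _ tendsto_const] by fastforce
  then have "integral (box a b) H = 0"
    using set_lebesgue_integral_eq_integral(2)[OF Hb] by (simp add: set_lebesgue_integral_def mult.commute)
  then show ?thesis by (simp add: integral_open_interval)
qed

text \<open>
  By Lebesgue differentiation, almost every value of \<open>H\<close> is the limit of its averages over
  small boxes.
\<close>

lemma negligible_of_box_integrals_eq_0: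
  fixes H :: "'a::euclidean_space \<Rightarrow> real"
  assumes H: "H integrable_on cbox a b"
    and zero: "\<And>c d. cbox c d \<subseteq> cbox a b \<Longrightarrow> integral (cbox c d) H = 0"
  shows "negligible {x \<in> cbox a b. H x \<noteq> 0}"
proof -
  define f where "f = (\<lambda>x. if x \<in> cbox a b then H x else 0)"
  have "f integrable_on cbox c d" for c d
  proof -
    obtain c' d' where cd: "cbox a b \<inter> cbox c d = cbox c' d'"
      using Int_interval[of a b c d] by blast
    then have "H integrable_on cbox c' d'"
      by (metis H inf_le1 integrable_on_subcbox)
    then show ?thesis
      unfolding f_def by (simp add: integrable_restrict_Int cd)
  qed
  then obtain N where N: "negligible N"
    and avg: "\<And>x e. x \<notin> N \<Longrightarrow> 0 < e \<Longrightarrow> \<exists>\<delta>>0. \<forall>h. 0 < h \<and> h < \<delta> \<longrightarrow>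
      norm (integral (cbox x (x + h *\<^sub>R One)) f /\<^sub>R h ^ DIM('a) - f x) < e"
    using integrable_ccontinuous_explicit[of f] by blast
  have "H x = 0" if x: "x \<in> box a b" "x \<notin> N" for x
  proof (rule ccontr)
    assume "H x \<noteq> 0"
    then obtain \<delta> where \<delta>: "\<delta> > 0" "\<And>h. 0 < h \<Longrightarrow> h < \<delta> \<Longrightarrow>
        norm (integral (cbox x (x + h *\<^sub>R One)) f /\<^sub>R h ^ DIM('a) - f x) < \<bar>H x\<bar>"
      using avg[OF x(2), of "\<bar>H x\<bar>"] by auto
    \<comment> \<open>Small boxes with lower corner \<open>x\<close> stay inside, so their averages vanish.\<close>
    have "((\<lambda>h. x + h *\<^sub>R One) \<longlongrightarrow> x + 0 *\<^sub>R One) (at_right 0)"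
      by (intro tendsto_intros)
    then have "\<forall>\<^sub>F h in at_right 0. x + h *\<^sub>R One \<in> box a b"
      using x(1) by (intro topological_tendstoD[OF _ open_box]) auto
    moreover have "\<forall>\<^sub>F h in at_right (0::real). h \<in> {0<..<\<delta>}"
      using \<open>\<delta> > 0\<close> by (rule eventually_at_right_real)
    ultimately have "\<forall>\<^sub>F h in at_right 0. x + h *\<^sub>R One \<in> box a b \<and> h \<in> {0<..<\<delta>}"
      by (rule eventually_conj)
    then obtain h where h: "x + h *\<^sub>R One \<in> box a b" "0 < h" "h < \<delta>"
      using eventually_happens'[OF trivial_limit_at_right_real] by fastforce
    have sub: "cbox x (x + h *\<^sub>R One) \<subseteq> cbox a b"
      using x h by (auto simp: subset_box mem_box less_imp_le)
    have "integral (cbox x (x + h *\<^sub>R One)) f = integral (cbox x (x + h *\<^sub>R One)) H"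
      by (rule integral_cong) (use sub in \<open>auto simp: f_def\<close>)
    also have "\<dots> = 0" by (rule zero[OF sub])
    finally show False
      using \<delta>(2)[OF h(2,3)] x box_subset_cbox[of a b] by (auto simp: f_def)
  qed
  then have "{x \<in> cbox a b. H x \<noteq> 0} \<subseteq> N \<union> (cbox a b - box a b)" by blast
  then show ?thesis
    using N negligible_frontier_interval negligible_Un negligible_subset by blast
qed

text \<open>
  The integrals of \<open>H\<close> over all closed boxes inside \<open>\<Omega>\<close> vanish, hence \<open>H\<close> vanishes almost everywhere in each
  such box, and countably many of them cover \<open>\<Omega>\<close>.
\<close>

lemma fundamental_lemma:
  fixes H :: "real^'n \<Rightarrow> real"
  assumes "open \<Omega>" "H locally_integrable_on \<Omega>"
    and "\<And>\<phi>. \<phi> \<in> test_functions \<Omega> \<Longrightarrow> (\<integral>x. H x * \<phi> x \<partial>lebesgue_on \<Omega>) = 0"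
  shows "AE x in lebesgue_on \<Omega>. H x = 0"
proof -
  obtain \<D> where \<D>: "countable \<D>" "\<D> \<subseteq> Pow \<Omega>" "\<And>X. X \<in> \<D> \<Longrightarrow> \<exists>a b. X = cbox a b" "\<Union>\<D> = \<Omega>"
    using open_countable_Union_open_cbox[OF \<open>open \<Omega>\<close>] by blast
  have "negligible {x \<in> X. H x \<noteq> 0}" if "X \<in> \<D>" for X
  proof -
    obtain a b where X: "X = cbox a b" "X \<subseteq> \<Omega>" using \<D>(2) \<D>(3)[OF \<open>X \<in> \<D>\<close>] \<open>X \<in> \<D>\<close> by blast
    then have "H integrable_on cbox a b"
      using assms(2) by (auto simp: locally_integrable_on_def absolutely_integrable_on_def)
    then show ?thesis
      using integral_box_eq_0[OF assms] X negligible_of_box_integrals_eq_0[of H a b] by blast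
  qed
  then have "negligible (\<Union>X\<in>\<D>. {x \<in> X. H x \<noteq> 0})"
    using \<D>(1) by (intro negligible_countable_Union) auto
  moreover have "(\<Union>X\<in>\<D>. {x \<in> X. H x \<noteq> 0}) = {x \<in> \<Omega>. H x \<noteq> 0}" using \<D>(4) by blast
  ultimately have "{x \<in> \<Omega>. H x \<noteq> 0} \<in> null_sets lebesgue"
    by (simp add: negligible_iff_null_sets)
  then have "AE x in lebesgue. x \<in> \<Omega> \<longrightarrow> H x = 0"
    by (rule AE_I') auto
  then show ?thesis
    using \<open>open \<Omega>\<close> by (subst AE_restrict_space_iff) auto
qed

lemma has_weak_gradient_component:
  assumes "has_weak_gradient \<Omega> u G"
  shows "(\<lambda>x. u x $ j) locally_integrable_on \<Omega>" "(\<lambda>x. G x $ j $ i) locally_integrable_on \<Omega>"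
  using assms unfolding has_weak_gradient_def
  by (auto intro!: locally_integrable_on_bounded_linear[of "\<lambda>y. y $ j"]
      locally_integrable_on_bounded_linear[of "\<lambda>y. y $ j $ i"] bounded_linear_vec_nth
      bounded_linear_compose[OF bounded_linear_vec_nth])

text \<open>
  The difference of two weak gradients has integral zero against every test function.
\<close>

lemma has_weak_gradient_unique:
  assumes "open \<Omega>" "has_weak_gradient \<Omega> u G" "has_weak_gradient \<Omega> u G'"
  shows "AE x in lebesgue_on \<Omega>. G x = G' x"
proof -
  have "AE x in lebesgue_on \<Omega>. G x $ j $ i = G' x $ j $ i" for i j
  proof -
    let ?H = "\<lambda>x. G x $ j $ i + (- 1) *\<^sub>R G' x $ j $ i"
    note li = has_weak_gradient_component(2)[OF assms(2)] has_weak_gradient_component(2)[OF assms(3)]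
    have "AE x in lebesgue_on \<Omega>. ?H x = 0"
    proof (rule fundamental_lemma[OF \<open>open \<Omega>\<close>])
      show "?H locally_integrable_on \<Omega>"
        using locally_integrable_on_add_scaleR[OF li, where c="- 1"] by simp
      fix \<phi> :: "real^'a \<Rightarrow> real" assume \<phi>: "\<phi> \<in> test_functions \<Omega>"
      have "(\<integral>x. G x $ j $ i * \<phi> x \<partial>lebesgue_on \<Omega>) = (\<integral>x. G' x $ j $ i * \<phi> x \<partial>lebesgue_on \<Omega>)"
        using assms(2,3) \<phi> unfolding has_weak_gradient_def by force
      then show "(\<integral>x. ?H x * \<phi> x \<partial>lebesgue_on \<Omega>) = 0"
        using integrable_mult_test_function[OF \<open>open \<Omega>\<close> li(1) \<phi>]
          integrable_mult_test_function[OF \<open>open \<Omega>\<close> li(2) \<phi>]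
        by (simp add: left_diff_distrib)
    qed
    then show ?thesis by eventually_elim simp
  qed
  then have "AE x in lebesgue_on \<Omega>. \<forall>j i. G x $ j $ i = G' x $ j $ i"
    by (intro eventually_all_finite)
  then show ?thesis by eventually_elim (simp add: vec_eq_iff)
qed

lemma has_weak_gradient_add_scaleR:
  assumes "open \<Omega>" "has_weak_gradient \<Omega> u G" "has_weak_gradient \<Omega> v H"
  shows "has_weak_gradient \<Omega> (\<lambda>x. u x + c *\<^sub>R v x) (\<lambda>x. G x + c *\<^sub>R H x)"
  unfolding has_weak_gradient_def
proof (intro conjI ballI allI)
  show "(\<lambda>x. u x + c *\<^sub>R v x) locally_integrable_on \<Omega>" "(\<lambda>x. G x + c *\<^sub>R H x) locally_integrable_on \<Omega>"
    using assms by (auto simp: has_weak_gradient_def locally_integrable_on_add_scaleR)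
  fix \<phi> :: "real^'a \<Rightarrow> real" and i j assume \<phi>: "\<phi> \<in> test_functions \<Omega>"
  note [simp] = integrable_mult_test_function[OF \<open>open \<Omega>\<close> has_weak_gradient_component(2)[OF assms(2)] \<phi>]
    integrable_mult_test_function[OF \<open>open \<Omega>\<close> has_weak_gradient_component(2)[OF assms(3)] \<phi>]
    integrable_mult_partial_test_function[OF \<open>open \<Omega>\<close> has_weak_gradient_component(1)[OF assms(2)] \<phi>]
    integrable_mult_partial_test_function[OF \<open>open \<Omega>\<close> has_weak_gradient_component(1)[OF assms(3)] \<phi>]
  have "(\<integral>x. u x $ j * partial_derivative i \<phi> x \<partial>lebesgue_on \<Omega>) =
        - (\<integral>x. G x $ j $ i * \<phi> x \<partial>lebesgue_on \<Omega>)"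
    "(\<integral>x. v x $ j * partial_derivative i \<phi> x \<partial>lebesgue_on \<Omega>) =
        - (\<integral>x. H x $ j $ i * \<phi> x \<partial>lebesgue_on \<Omega>)"
    using assms(2,3) \<phi> by (auto simp: has_weak_gradient_def)
  then show "(\<integral>x. (u x + c *\<^sub>R v x) $ j * partial_derivative i \<phi> x \<partial>lebesgue_on \<Omega>) =
        - (\<integral>x. (G x + c *\<^sub>R H x) $ j $ i * \<phi> x \<partial>lebesgue_on \<Omega>)"
    by (simp add: ring_distribs mult.assoc)
qed

text \<open>
  This lemma replaces the arbitrary choice in the definition of \<open>weak_gradient\<close> by any weak gradient at hand.
\<close>

lemma weak_gradient_AE:
  assumes "open \<Omega>" "has_weak_gradient \<Omega> u G"
  shows "has_weak_gradient \<Omega> u (weak_gradient \<Omega> u)"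
    and "AE x in lebesgue_on \<Omega>. weak_gradient \<Omega> u x = G x"
proof -
  show "has_weak_gradient \<Omega> u (weak_gradient \<Omega> u)"
    using assms(2) unfolding weak_gradient_def by (rule someI[of "has_weak_gradient \<Omega> u"])
  then show "AE x in lebesgue_on \<Omega>. weak_gradient \<Omega> u x = G x"
    using has_weak_gradient_unique assms by blast
qed

section \<open>Integration by parts for test functions\<close>

text \<open>
  The difference quotients of \<open>g\<close> in direction \<open>e\<close> have integral zero, since Lebesgue measure is translation
  invariant. By the mean value theorem they are bounded by \<open>B\<close>, and for steps of size at most one they
  vanish outside a fixed ball, so dominated convergence gives the claim for their limit.
\<close>

lemma has_bochner_integral_directional_derivative:
  fixes g g' :: "'a::euclidean_space \<Rightarrow> real"
  assumes g: "continuous_on UNIV g"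
    and supp: "\<And>x. R < norm x \<Longrightarrow> g x = 0"
    and deriv: "\<And>x. ((\<lambda>t. g (x + t *\<^sub>R e)) has_real_derivative g' x) (at 0)"
    and bound: "\<And>x. \<bar>g' x\<bar> \<le> B"
  shows "has_bochner_integral lborel g' 0"
proof -
  define t where "t = (\<lambda>m. inverse (real (Suc m)))"
  have t: "0 < t m" "t m \<le> 1" for m
    by (auto simp: t_def divide_simps)
  define s where "s = (\<lambda>m x. (g (x + t m *\<^sub>R e) - g x) / t m)"
  define w where "w = (\<lambda>x::'a. indicator (cball 0 (R + norm e)) x *\<^sub>R B)"
  have [measurable]: "g \<in> borel_measurable borel" using g by (rule borel_measurable_continuous_onI)
  have g_int: "integrable lborel g"
  proof -
    have "integrable lborel (\<lambda>x. indicator (cball 0 R) x *\<^sub>R g x)"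
      by (intro borel_integrable_compact) (auto intro: continuous_on_subset[OF g])
    moreover have "(\<lambda>x. indicator (cball 0 R) x *\<^sub>R g x) = g"
    proof
      show "indicator (cball 0 R) x *\<^sub>R g x = g x" for x
        using supp[of x] by (cases "x \<in> cball 0 R") (auto simp: not_le)
    qed
    ultimately show ?thesis by metis
  qed
  have s_meas: "s m \<in> borel_measurable lborel" for m
    unfolding s_def by measurable
  have t_lim: "filterlim t (at 0) sequentially"
    unfolding filterlim_at using LIMSEQ_inverse_real_of_nat t
    by (auto simp: t_def[symmetric] less_imp_neq[symmetric]) (simp add: t_def)
  have lim: "(\<lambda>m. s m x) \<longlonglongrightarrow> g' x" for x
  proof -
    have "((\<lambda>h. (g (x + h *\<^sub>R e) - g x) / h) \<longlongrightarrow> g' x) (at 0)"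
      using deriv[of x] by (simp add: DERIV_def)
    then show ?thesis
      unfolding s_def by (rule filterlim_compose[OF _ t_lim])
  qed
  have g'_meas: "g' \<in> borel_measurable lborel"
    by (rule borel_measurable_LIMSEQ_metric[OF s_meas lim])
  have bnd: "norm (s m x) \<le> w x" for m x
  proof (cases "norm x \<le> R + norm e")
    case True
    have "((\<lambda>t. g (x + t *\<^sub>R e)) has_real_derivative g' (x + r *\<^sub>R e)) (at r)" for r
      using deriv[of "x + r *\<^sub>R e"] DERIV_shift[of "\<lambda>t. g (x + t *\<^sub>R e)" _ 0 r]
      by (simp add: algebra_simps)
    then obtain z where "g (x + t m *\<^sub>R e) - g (x + 0 *\<^sub>R e) = (t m - 0) * g' (x + z *\<^sub>R e)"
      using MVT2[OF t(1)[of m], of "\<lambda>t. g (x + t *\<^sub>R e)" "\<lambda>r. g' (x + r *\<^sub>R e)"] by blast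
    then have "s m x = g' (x + z *\<^sub>R e)"
      using t(1)[of m] by (simp add: s_def)
    then show ?thesis
      using bound True by (simp add: w_def)
  next
    case False
    have "norm (t m *\<^sub>R e) \<le> norm e"
      using t[of m] by (simp add: mult_left_le_one_le)
    then have "R < norm (x + t m *\<^sub>R e)" 
      using False norm_diff_ineq[of x "t m *\<^sub>R e"] by linarith
    moreover have "R < norm x" using False norm_ge_zero[of e] by linarith
    ultimately show ?thesis
      using False supp by (simp add: s_def w_def)
  qed
  have w: "integrable lborel w"
    unfolding w_def by (intro borel_integrable_compact) auto
  have "integrable lborel g'"
    by (rule integrable_dominated_convergence[OF g'_meas s_meas w]) (use bnd in \<open>auto intro: lim\<close>)
  have "(\<lambda>m. integral\<^sup>L lborel (s m)) \<longlonglongrightarrow> integral\<^sup>L lborel g'"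
    by (rule integral_dominated_convergence[OF g'_meas s_meas w]) (use bnd in \<open>auto intro: lim\<close>)
  moreover have "integral\<^sup>L lborel (s m) = 0" for m
  proof -
    have "integral\<^sup>L lborel g = integral\<^sup>L (distr lborel borel ((+) (t m *\<^sub>R e))) g"
      by (simp add: lborel_distr_plus)
    also have "\<dots> = (\<integral>x. g (x + t m *\<^sub>R e) \<partial>lborel)"
      by (subst integral_distr) (auto simp: add.commute)
    finally have "(\<integral>x. g (x + t m *\<^sub>R e) \<partial>lborel) = integral\<^sup>L lborel g" by simp
    moreover have "integrable lborel (\<lambda>x. g (x + t m *\<^sub>R e))"
    proof -
      have "integrable (distr lborel borel ((+) (t m *\<^sub>R e))) g"
        using g_int by (simp add: lborel_distr_plus)
      then show ?thesis
        by (subst (asm) integrable_distr_eq) (auto simp: add.commute)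
    qed
    ultimately show ?thesis
      using g_int by (simp add: s_def)
  qed
  ultimately have "integral\<^sup>L lborel g' = 0"
    using LIMSEQ_unique[OF _ tendsto_const[of 0]] by fastforce
  with \<open>integrable lborel g'\<close> show ?thesis
    by (simp add: has_bochner_integral_iff)
qed

lemma differentiable_imp_partial_derivative:
  assumes "\<phi> differentiable (at x)"
  shows "((\<lambda>t. \<phi> (x + t *\<^sub>R axis i 1)) has_vector_derivative partial_derivative i \<phi> x) (at 0)"
proof -
  have "(\<phi> has_derivative frechet_derivative \<phi> (at x)) (at (x + 0 *\<^sub>R axis i 1))"
    using assms[unfolded frechet_derivative_works] by simp
  moreover have "((\<lambda>t. x + t *\<^sub>R axis i 1) has_vector_derivative axis i (1::real)) (at 0)"
    by (auto intro!: derivative_eq_intros)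
  ultimately show ?thesis
    using vector_derivative_diff_chain_within[of "\<lambda>t. x + t *\<^sub>R axis i 1" "axis i 1" 0 UNIV \<phi>]
    by (simp add: comp_def partial_derivative_def has_derivative_at_withinI)
qed

lemma test_function_bounded:
  assumes "\<phi> \<in> test_functions \<Omega>"
  obtains B where "\<And>x. norm (\<phi> x) \<le> B" "\<And>x. norm (partial_derivative i \<phi> x) \<le> B"
proof -
  let ?K = "closure {x. \<phi> x \<noteq> 0}"
  note \<phi> = test_functionsD[OF assms]
  have "bounded (\<phi> ` ?K)" "bounded (partial_derivative i \<phi> ` ?K)"
    using \<phi>(1,3,5) by (auto intro!: compact_imp_bounded compact_continuous_image intro: continuous_on_subset)
  then obtain B1 B2 where B: "\<forall>x\<in>?K. norm (\<phi> x) \<le> B1" "\<forall>x\<in>?K. norm (partial_derivative i \<phi> x) \<le> B2"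
    unfolding bounded_iff by (meson imageI)
  show thesis
  proof (rule that)
    show "norm (\<phi> x) \<le> max 0 (max B1 B2)" "norm (partial_derivative i \<phi> x) \<le> max 0 (max B1 B2)" for x
    proof -
      have "norm (\<phi> x) \<le> B1 \<and> norm (partial_derivative i \<phi> x) \<le> B2 \<or> \<phi> x = 0 \<and> partial_derivative i \<phi> x = 0"
        using B \<phi>(6) partial_derivative_outside_support by blast
      then show "norm (\<phi> x) \<le> max 0 (max B1 B2)" "norm (partial_derivative i \<phi> x) \<le> max 0 (max B1 B2)"
        by auto
    qed
  qed
qed

lemma test_function_vanishes_far:
  assumes "\<phi> \<in> test_functions \<Omega>"
  obtains R where "\<And>x. R < norm x \<Longrightarrow> \<phi> x = 0"
proof -
  obtain R where R: "\<forall>x\<in>closure {x. \<phi> x \<noteq> 0}. norm x \<le> R"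
    using compact_imp_bounded[OF test_functionsD(1)[OF assms]] unfolding bounded_iff by blast
  show thesis
  proof (rule that)
    fix x :: "real^'a" assume "R < norm x"
    with R have "x \<notin> closure {x. \<phi> x \<noteq> 0}" by (meson not_le)
    then show "\<phi> x = 0" by (rule test_functionsD(6)[OF assms])
  qed
qed

text \<open>
  The partial derivative of the product \<open>\<phi>\<^sub>j \<psi>\<close> has integral zero.
\<close>

lemma integration_by_parts_test_functions:
  fixes \<phi> :: "real^'n \<Rightarrow> real^'d" and \<psi> :: "real^'n \<Rightarrow> real"
  assumes \<phi>: "\<phi> \<in> test_functions \<Omega>" and \<psi>: "\<psi> \<in> test_functions \<Omega>"
  shows "(\<integral>x. \<phi> x $ j * partial_derivative i \<psi> x \<partial>lebesgue) =
    - (\<integral>x. partial_derivative i \<phi> x $ j * \<psi> x \<partial>lebesgue)"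
proof -
  let ?K = "closure {x. \<psi> x \<noteq> 0}"
  note D\<phi> = test_functionsD[OF \<phi>] and D\<psi> = test_functionsD[OF \<psi>]
  let ?g' = "\<lambda>x. \<phi> x $ j * partial_derivative i \<psi> x + partial_derivative i \<phi> x $ j * \<psi> x"
  obtain B where B: "\<And>x. norm (\<phi> x) \<le> B" "\<And>x. norm (partial_derivative i \<phi> x) \<le> B"
    using test_function_bounded[OF \<phi>, where i=i] by blast
  obtain C where C: "\<And>x. norm (\<psi> x) \<le> C" "\<And>x. norm (partial_derivative i \<psi> x) \<le> C"
    using test_function_bounded[OF \<psi>, where i=i] by blast
  obtain R where R: "\<And>x. R < norm x \<Longrightarrow> \<psi> x = 0"
    using test_function_vanishes_far[OF \<psi>] by blast
  have cont: "continuous_on UNIV (\<lambda>x. \<phi> x $ j)" "continuous_on UNIV (\<lambda>x. partial_derivative i \<phi> x $ j)"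
    using D\<phi>(3,5) by (auto intro!: continuous_intros)
  have int: "integrable lebesgue (\<lambda>x. \<phi> x $ j * partial_derivative i \<psi> x)"
      "integrable lebesgue (\<lambda>x. partial_derivative i \<phi> x $ j * \<psi> x)"
  proof -
    obtain a b where ab: "?K \<subseteq> cbox a b"
      using bounded_subset_cbox_symmetric[OF compact_imp_bounded[OF D\<psi>(1)]] by blast
    have ai: "h absolutely_integrable_on cbox a b" if "continuous_on UNIV h" for h :: "real^'n \<Rightarrow> real"
      by (rule absolutely_integrable_continuous[OF continuous_on_subset[OF that]]) simp
    have out: "\<psi> x = 0" "partial_derivative i \<psi> x = 0" if "x \<notin> cbox a b" for x
      using that ab D\<psi>(6)[of x] partial_derivative_outside_support[of x \<psi> i] by blast+
    show "integrable lebesgue (\<lambda>x. \<phi> x $ j * partial_derivative i \<psi> x)"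
      by (rule integrable_mult_compact_support[OF ai[OF cont(1)] compact_cbox D\<psi>(5) out(2)])
    show "integrable lebesgue (\<lambda>x. partial_derivative i \<phi> x $ j * \<psi> x)"
      by (rule integrable_mult_compact_support[OF ai[OF cont(2)] compact_cbox D\<psi>(3) out(1)])
  qed
  have "has_bochner_integral lborel ?g' 0"
  proof (rule has_bochner_integral_directional_derivative)
    show "continuous_on UNIV (\<lambda>x. \<phi> x $ j * \<psi> x)"
      by (rule continuous_on_mult[OF cont(1) D\<psi>(3)])
    show "\<phi> x $ j * \<psi> x = 0" if "R < norm x" for x
      using R that by simp
    show "((\<lambda>t. \<phi> (x + t *\<^sub>R axis i 1) $ j * \<psi> (x + t *\<^sub>R axis i 1)) has_real_derivative ?g' x) (at 0)" for x
    proof -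
      have "((\<lambda>t. \<phi> (x + t *\<^sub>R axis i 1) $ j) has_vector_derivative partial_derivative i \<phi> x $ j) (at 0)"
        by (rule bounded_linear.has_vector_derivative[OF bounded_linear_vec_nth
              differentiable_imp_partial_derivative[OF D\<phi>(4)]])
      moreover have "((\<lambda>t. \<psi> (x + t *\<^sub>R axis i 1)) has_vector_derivative partial_derivative i \<psi> x) (at 0)"
        by (rule differentiable_imp_partial_derivative[OF D\<psi>(4)])
      ultimately show ?thesis
        by (auto simp flip: has_real_derivative_iff_has_vector_derivative intro!: derivative_eq_intros)
    qed
    show "\<bar>?g' x\<bar> \<le> B * C + B * C" for x
    proof -
      have "\<bar>\<phi> x $ j\<bar> * \<bar>partial_derivative i \<psi> x\<bar> \<le> B * C"
        "\<bar>partial_derivative i \<phi> x $ j\<bar> * \<bar>\<psi> x\<bar> \<le> B * C"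
        using B[of x] C[of x] component_le_norm_cart[of "\<phi> x" j] component_le_norm_cart[of "partial_derivative i \<phi> x" j]
        by (auto intro!: mult_mono)
      then show ?thesis
        using abs_triangle_ineq[of "\<phi> x $ j * partial_derivative i \<psi> x" "partial_derivative i \<phi> x $ j * \<psi> x"]
        by (simp add: abs_mult)
    qed
  qed
  moreover have "?g' \<in> borel_measurable lborel"
    using continuous_on_add[OF continuous_on_mult[OF cont(1) D\<psi>(5)] continuous_on_mult[OF cont(2) D\<psi>(3)]]
    by (auto intro: borel_measurable_continuous_onI)
  ultimately have "integral\<^sup>L lebesgue ?g' = 0"
    by (subst integral_completion) (auto dest: has_bochner_integral_integral_eq)
  then show ?thesis using int by simp
qed

definition classical_gradient :: "(real^'n \<Rightarrow> real^'d) \<Rightarrow> real^'n \<Rightarrow> real^'n^'d" where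
  "classical_gradient \<phi> x = (\<chi> j i. partial_derivative i \<phi> x $ j)"

lemma continuous_classical_gradient:
  assumes "\<phi> \<in> test_functions \<Omega>"
  shows "continuous_on UNIV (classical_gradient \<phi>)"
  unfolding classical_gradient_def[abs_def]
  by (intro continuous_on_vec_lambda continuous_intros test_functionsD(5)[OF assms])

lemma continuous_imp_locally_integrable_on:
  assumes "continuous_on UNIV u"
  shows "u locally_integrable_on \<Omega>"
  unfolding locally_integrable_on_def
proof (intro allI impI)
  fix K :: "(real^'a) set" assume K: "compact K \<and> K \<subseteq> \<Omega>"
  then obtain a where "K \<subseteq> cbox (- a) a"
    using bounded_subset_cbox_symmetric[OF compact_imp_bounded] by blast
  moreover have "u absolutely_integrable_on cbox (- a) a"
    by (rule absolutely_integrable_continuous[OF continuous_on_subset[OF assms]]) simp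
  ultimately show "u absolutely_integrable_on K"
    using K set_integrable_subset[of lebesgue "cbox (- a) a" u K] by (simp add: fmeasurableD lmeasurable_compact)
qed

lemma has_weak_gradient_test_function:
  fixes \<phi> :: "real^'n \<Rightarrow> real^'d"
  assumes "open \<Omega>" "\<phi> \<in> test_functions \<Omega>"
  shows "has_weak_gradient \<Omega> \<phi> (classical_gradient \<phi>)"
  unfolding has_weak_gradient_def
proof (intro conjI ballI allI)
  show "\<phi> locally_integrable_on \<Omega>" "classical_gradient \<phi> locally_integrable_on \<Omega>"
    using continuous_imp_locally_integrable_on test_functionsD(3)[OF assms(2)]
      continuous_classical_gradient[OF assms(2)] by blast+
  fix \<psi> :: "real^'n \<Rightarrow> real" and i j assume \<psi>: "\<psi> \<in> test_functions \<Omega>"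
  have \<Omega>: "\<Omega> \<in> sets lebesgue" using \<open>open \<Omega>\<close> by (simp add: borel_open)
  have out: "\<psi> x = 0" "partial_derivative i \<psi> x = 0" if "x \<notin> \<Omega>" for x
    using that test_functionsD(2,6)[OF \<psi>] partial_derivative_outside_support[of x \<psi> i] by blast+
  have "(\<integral>x. \<phi> x $ j * partial_derivative i \<psi> x \<partial>lebesgue_on \<Omega>) =
      (\<integral>x. \<phi> x $ j * partial_derivative i \<psi> x \<partial>lebesgue)"
    by (rule integral_lebesgue_on_supported[OF \<Omega>]) (simp add: out)
  moreover have "(\<integral>x. partial_derivative i \<phi> x $ j * \<psi> x \<partial>lebesgue_on \<Omega>) =
      (\<integral>x. partial_derivative i \<phi> x $ j * \<psi> x \<partial>lebesgue)"
    by (rule integral_lebesgue_on_supported[OF \<Omega>]) (simp add: out)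
  ultimately show "(\<integral>x. \<phi> x $ j * partial_derivative i \<psi> x \<partial>lebesgue_on \<Omega>) =
      - (\<integral>x. classical_gradient \<phi> x $ j $ i * \<psi> x \<partial>lebesgue_on \<Omega>)"
    using integration_by_parts_test_functions[OF assms(2) \<psi>, of j i]
    by (simp add: classical_gradient_def)
qed

section \<open>The Poincare inequality\<close>

text \<open>
  At a zero of \<open>y\<close> the norm is not differentiable; there \<open>norm (y t)\<close> is at most a multiple of \<open>|t - s|\<close>, so
  its power with exponent \<open>p > 1\<close> has derivative zero, in agreement with the formula as \<open>y s = 0\<close>.
\<close>

lemma has_real_derivative_norm_powr:
  fixes y :: "real \<Rightarrow> 'b::real_inner"
  assumes y: "(y has_vector_derivative y') (at s)" and p: "1 < p"
  shows "((\<lambda>t. norm (y t) powr p) has_real_derivative p * norm (y s) powr (p - 2) * (y s \<bullet> y')) (at s)"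
proof (cases "y s = 0")
  case False
  have "((\<lambda>t. norm (y t)) has_derivative (\<lambda>h. (h *\<^sub>R y') \<bullet> sgn (y s))) (at s)"
    using has_derivative_compose[OF y[unfolded has_vector_derivative_def] has_derivative_norm[OF False]] 
    by (simp add: inner_commute)
  then have "((\<lambda>t. norm (y t)) has_real_derivative (y s \<bullet> y') / norm (y s)) (at s)"
    by (simp add: has_field_derivative_def sgn_div_norm divide_inverse mult_ac inner_commute
        mult_commute_abs)
  then have "((\<lambda>t. norm (y t) powr p) has_real_derivative
      p * norm (y s) powr (p - of_nat 1) * ((y s \<bullet> y') / norm (y s))) (at s)"
    using False by (intro DERIV_fun_powr) auto
  moreover have "norm (y s) powr (p - 1) = norm (y s) powr (p - 2) * norm (y s)"
    using False powr_add[of "norm (y s)" "p - 2" 1] by simp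
  ultimately show ?thesis using False by (simp add: mult.assoc)
next
  case True
  have bl: "((\<lambda>h. norm (y (s + h) - y s - h *\<^sub>R y') / norm h) \<longlongrightarrow> 0) (at 0)"
    using y by (simp add: has_vector_derivative_def has_derivative_at)
  then have ev: "\<forall>\<^sub>F h in at 0. norm (y (s + h) - h *\<^sub>R y') / \<bar>h\<bar> < 1"
    using order_tendstoD(2)[OF bl, of 1] True by simp
  have cont: "((\<lambda>h. y (s + h)) \<longlongrightarrow> 0) (at 0)"
    using has_vector_derivative_continuous[OF y] True by (simp add: isCont_iff)
  have "((\<lambda>h. norm (y (s + h)) powr (p - 1)) \<longlongrightarrow> 0 powr (p - 1)) (at 0)"
    by (rule tendsto_powr') (use p cont tendsto_norm_zero in auto)
  then have z: "((\<lambda>h. (1 + norm y') * norm (y (s + h)) powr (p - 1)) \<longlongrightarrow> 0) (at 0)"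
    using tendsto_mult_right_zero by force
  have "((\<lambda>h. (norm (y (s + h)) powr p - norm (y s) powr p) / h) \<longlongrightarrow> 0) (at 0)"
  proof (rule Lim_null_comparison[OF _ z])
    show "\<forall>\<^sub>F h in at 0. norm ((norm (y (s + h)) powr p - norm (y s) powr p) / h)
        \<le> (1 + norm y') * norm (y (s + h)) powr (p - 1)"
      using ev eventually_neq_at_within[of 0]
    proof eventually_elim
      case (elim h)
      have "norm (y (s + h)) \<le> norm (y (s + h) - h *\<^sub>R y') + \<bar>h\<bar> * norm y'"
        using norm_triangle_ineq[of "y (s + h) - h *\<^sub>R y'" "h *\<^sub>R y'"] by simp
      also have "\<dots> \<le> (1 + norm y') * \<bar>h\<bar>"
        using elim by (simp add: field_simps)
      finally have *: "norm (y (s + h)) / \<bar>h\<bar> \<le> 1 + norm y'"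
        using elim by (simp add: field_simps)
      have "norm (y (s + h)) powr p = norm (y (s + h)) * norm (y (s + h)) powr (p - 1)"
        by (simp add: powr_mult_base)
      then have "norm ((norm (y (s + h)) powr p - norm (y s) powr p) / h)
          = norm (y (s + h)) / \<bar>h\<bar> * norm (y (s + h)) powr (p - 1)"
        using True p by (simp add: abs_mult)
      also have "\<dots> \<le> (1 + norm y') * norm (y (s + h)) powr (p - 1)"
        using * by (rule mult_right_mono) simp
      finally show ?case .
    qed
  qed
  then show ?thesis
    using True by (simp add: DERIV_def)
qed

text \<open>
  A form of Young's inequality whose constant is explicit. If \<open>2 c b \<le> a\<close>, the first summand on the
  right dominates; otherwise \<open>a\<close> may be replaced by \<open>2 c b\<close>, which gives the second summand.
\<close>

lemma young_absorption:
  fixes a b c p :: real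
  assumes "0 \<le> a" "0 \<le> b" "0 \<le> c" "1 < p"
  shows "c * a powr (p - 1) * b \<le> a powr p / 2 + c * (2 * c) powr (p - 1) * b powr p"
proof (cases "2 * c * b \<le> a")
  case True
  have "c * a powr (p - 1) * b = a powr (p - 1) * (c * b)" by simp
  also have "\<dots> \<le> a powr (p - 1) * (a / 2)"
    using True by (intro mult_left_mono) auto
  also have "\<dots> = a powr p / 2"
    using powr_mult_base[of a "p - 1"] assms by (simp add: mult.commute)
  finally show ?thesis
    using assms by (simp add: add_increasing2)
next
  case False
  have "a powr (p - 1) \<le> (2 * c * b) powr (p - 1)"
    using False assms by (intro powr_mono2) auto
  then have "c * a powr (p - 1) * b \<le> c * (2 * c * b) powr (p - 1) * b"
    using assms by (intro mult_right_mono mult_left_mono) auto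
  also have "\<dots> = c * (2 * c) powr (p - 1) * (b * b powr (p - 1))"
    using assms by (simp add: powr_mult)
  also have "\<dots> = c * (2 * c) powr (p - 1) * b powr p"
    using assms by (simp add: powr_mult_base)
  finally show ?thesis by (simp add: add_increasing)
qed

text \<open>
  A form of Minkowski's inequality for the \<open>p\<close>-th powers, with a constant; the sum is at most twice the
  larger norm.
\<close>

lemma norm_add_powr_le:
  fixes a b :: "'a::real_normed_vector"
  assumes "0 \<le> p"
  shows "norm (a + b) powr p \<le> 2 powr p * (norm a powr p + norm b powr p)"
proof -
  have "norm (a + b) powr p \<le> (2 * max (norm a) (norm b)) powr p"
    using norm_triangle_ineq[of a b] assms by (intro powr_mono2) auto
  also have "\<dots> = 2 powr p * max (norm a) (norm b) powr p"
    by (simp add: powr_mult)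
  also have "\<dots> \<le> 2 powr p * (norm a powr p + norm b powr p)"
    by (intro mult_left_mono) (auto simp: max_def)
  finally show ?thesis .
qed

definition Lp_integral :: "(real^'n) set \<Rightarrow> real \<Rightarrow> (real^'n \<Rightarrow> 'b::real_normed_vector) \<Rightarrow> real" where
  "Lp_integral \<Omega> p u = (\<integral>x. norm (u x) powr p \<partial>lebesgue_on \<Omega>)"

lemma Lp_integral_nonneg: "0 \<le> Lp_integral \<Omega> p u"
  by (simp add: Lp_integral_def)

lemma Lp_measurableD: "u \<in> Lp \<Omega> p \<Longrightarrow> u \<in> borel_measurable (lebesgue_on \<Omega>)"
  and Lp_integrableD: "u \<in> Lp \<Omega> p \<Longrightarrow> integrable (lebesgue_on \<Omega>) (\<lambda>x. norm (u x) powr p)"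
  by (auto simp: Lp_def)

lemma Lp_AE_cong:
  assumes "u \<in> Lp \<Omega> p" "v \<in> borel_measurable (lebesgue_on \<Omega>)" "AE x in lebesgue_on \<Omega>. v x = u x"
  shows "v \<in> Lp \<Omega> p" and "Lp_integral \<Omega> p v = Lp_integral \<Omega> p u"
proof -
  note [measurable] = assms(2) Lp_measurableD[OF assms(1)]
  have ae: "AE x in lebesgue_on \<Omega>. norm (v x) powr p = norm (u x) powr p"
    using assms(3) by eventually_elim simp
  have "integrable (lebesgue_on \<Omega>) (\<lambda>x. norm (v x) powr p)"
    using Lp_integrableD[OF assms(1)] by (subst integrable_cong_AE[OF _ _ ae]) auto
  then show "v \<in> Lp \<Omega> p" using assms(2) by (simp add: Lp_def)
  show "Lp_integral \<Omega> p v = Lp_integral \<Omega> p u"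
    unfolding Lp_integral_def by (rule integral_cong_AE[OF _ _ ae]) auto
qed

lemma Lp_add:
  assumes "u \<in> Lp \<Omega> p" "v \<in> Lp \<Omega> p" "0 \<le> p"
  shows "(\<lambda>x. u x + v x) \<in> Lp \<Omega> p"
    and "Lp_integral \<Omega> p (\<lambda>x. u x + v x) \<le> 2 powr p * (Lp_integral \<Omega> p u + Lp_integral \<Omega> p v)"
proof -
  note [measurable] = Lp_measurableD[OF assms(1)] Lp_measurableD[OF assms(2)]
  note int = Lp_integrableD[OF assms(1)] Lp_integrableD[OF assms(2)]
  have dom: "integrable (lebesgue_on \<Omega>) (\<lambda>x. 2 powr p * (norm (u x) powr p + norm (v x) powr p))"
    using int by simp
  have "integrable (lebesgue_on \<Omega>) (\<lambda>x. norm (u x + v x) powr p)"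
    by (rule Bochner_Integration.integrable_bound[OF dom]) (auto simp: norm_add_powr_le[OF assms(3)])
  then show "(\<lambda>x. u x + v x) \<in> Lp \<Omega> p" by (simp add: Lp_def)
  have "Lp_integral \<Omega> p (\<lambda>x. u x + v x) \<le> (\<integral>x. 2 powr p * (norm (u x) powr p + norm (v x) powr p) \<partial>lebesgue_on \<Omega>)"
    unfolding Lp_integral_def using dom
    by (rule integral_mono[rotated]) (auto simp: norm_add_powr_le[OF assms(3)] \<open>integrable _ (\<lambda>x. norm (u x + v x) powr p)\<close>)
  also have "\<dots> = 2 powr p * (Lp_integral \<Omega> p u + Lp_integral \<Omega> p v)"
    using int by (simp add: Lp_integral_def)
  finally show "Lp_integral \<Omega> p (\<lambda>x. u x + v x) \<le> 2 powr p * (Lp_integral \<Omega> p u + Lp_integral \<Omega> p v)" .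
qed

lemma Lp_integral_minus_commute: "Lp_integral \<Omega> p (\<lambda>x. u x - v x) = Lp_integral \<Omega> p (\<lambda>x. v x - u x)"
  by (simp add: Lp_integral_def norm_minus_commute)

lemma Lp_scaleR: "u \<in> Lp \<Omega> p \<Longrightarrow> (\<lambda>x. c *\<^sub>R u x) \<in> Lp \<Omega> p"
  by (auto simp: Lp_def powr_mult)

lemma Lp_integral_le_diff:
  assumes "u \<in> Lp \<Omega> p" "v \<in> Lp \<Omega> p" "0 \<le> p"
  shows "Lp_integral \<Omega> p u \<le> 2 powr p * (Lp_integral \<Omega> p v + Lp_integral \<Omega> p (\<lambda>x. v x - u x))"
proof -
  have "(\<lambda>x. u x + (- 1) *\<^sub>R v x) \<in> Lp \<Omega> p"
    using assms by (intro Lp_add Lp_scaleR)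
  from Lp_add(2)[OF assms(2) this assms(3)] show ?thesis
    by (simp add: Lp_integral_minus_commute[of \<Omega> p u v])
qed

lemma W1p_weak_gradientD:
  assumes "open \<Omega>" "u \<in> W1p \<Omega> p"
  shows "has_weak_gradient \<Omega> u (weak_gradient \<Omega> u)" and "weak_gradient \<Omega> u \<in> Lp \<Omega> p"
proof -
  obtain G where G: "G \<in> Lp \<Omega> p" "has_weak_gradient \<Omega> u G"
    using assms(2) by (auto simp: W1p_def)
  note wg = weak_gradient_AE[OF assms(1) G(2)]
  show "has_weak_gradient \<Omega> u (weak_gradient \<Omega> u)" by (rule wg)
  then have "weak_gradient \<Omega> u \<in> borel_measurable (lebesgue_on \<Omega>)"
    using locally_integrable_on_imp_measurable[OF assms(1)] unfolding has_weak_gradient_def by blast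
  then show "weak_gradient \<Omega> u \<in> Lp \<Omega> p"
    using Lp_AE_cong(1)[OF G(1) _ wg(2)] by blast
qed

lemma W1p_add_scaleR:
  assumes "open \<Omega>" "u \<in> W1p \<Omega> p" "v \<in> W1p \<Omega> p" "0 \<le> p"
  shows "(\<lambda>x. u x + c *\<^sub>R v x) \<in> W1p \<Omega> p"
    and "Lp_integral \<Omega> p (weak_gradient \<Omega> (\<lambda>x. u x + c *\<^sub>R v x)) =
      Lp_integral \<Omega> p (\<lambda>x. weak_gradient \<Omega> u x + c *\<^sub>R weak_gradient \<Omega> v x)"
proof -
  note u = W1p_weak_gradientD[OF assms(1,2)] and v = W1p_weak_gradientD[OF assms(1,3)]
  have uv: "has_weak_gradient \<Omega> (\<lambda>x. u x + c *\<^sub>R v x) (\<lambda>x. weak_gradient \<Omega> u x + c *\<^sub>R weak_gradient \<Omega> v x)"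
    by (rule has_weak_gradient_add_scaleR[OF assms(1) u(1) v(1)])
  have lp: "(\<lambda>x. weak_gradient \<Omega> u x + c *\<^sub>R weak_gradient \<Omega> v x) \<in> Lp \<Omega> p"
    using u(2) v(2) assms(4) by (intro Lp_add Lp_scaleR)
  moreover have "(\<lambda>x. u x + c *\<^sub>R v x) \<in> Lp \<Omega> p"
    using assms by (intro Lp_add Lp_scaleR) (auto simp: W1p_def)
  ultimately show *: "(\<lambda>x. u x + c *\<^sub>R v x) \<in> W1p \<Omega> p"
    using uv by (auto simp: W1p_def)
  show "Lp_integral \<Omega> p (weak_gradient \<Omega> (\<lambda>x. u x + c *\<^sub>R v x)) =
      Lp_integral \<Omega> p (\<lambda>x. weak_gradient \<Omega> u x + c *\<^sub>R weak_gradient \<Omega> v x)"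
    using Lp_AE_cong(2)[OF lp Lp_measurableD[OF W1p_weak_gradientD(2)[OF assms(1) *]]]
      weak_gradient_AE(2)[OF assms(1) uv] by blast
qed

lemma W1p_diff:
  assumes "open \<Omega>" "u \<in> W1p \<Omega> p" "v \<in> W1p \<Omega> p" "0 \<le> p"
  shows "(\<lambda>x. u x - v x) \<in> W1p \<Omega> p"
    and "Lp_integral \<Omega> p (weak_gradient \<Omega> (\<lambda>x. u x - v x)) =
      Lp_integral \<Omega> p (\<lambda>x. weak_gradient \<Omega> u x - weak_gradient \<Omega> v x)"
  using W1p_add_scaleR[OF assms, of "- 1"] by simp_all

lemma W1p_norm_eq:
  "W1p_norm \<Omega> p u = (Lp_integral \<Omega> p u + Lp_integral \<Omega> p (weak_gradient \<Omega> u)) powr (1 / p)"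
  by (simp add: W1p_norm_def Lp_integral_def)

lemma continuous_on_norm_powr:
  assumes "continuous_on S \<phi>" "0 < p"
  shows "continuous_on S (\<lambda>x. norm (\<phi> x) powr p)"
  using assms by (intro continuous_on_powr' continuous_intros) auto

lemma compact_support_imp_Lp:
  fixes h :: "real^'n \<Rightarrow> 'b::euclidean_space"
  assumes "open \<Omega>" "continuous_on UNIV h" "compact K" "\<And>x. x \<notin> K \<Longrightarrow> h x = 0" "0 < p"
  shows "integrable lborel (\<lambda>x. norm (h x) powr p)" and "h \<in> Lp \<Omega> p"
    and "K \<subseteq> \<Omega> \<Longrightarrow> Lp_integral \<Omega> p h = (\<integral>x. norm (h x) powr p \<partial>lborel)"
proof -
  have \<Omega>: "\<Omega> \<in> sets lebesgue" using \<open>open \<Omega>\<close> by (simp add: borel_open)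
  have cont: "continuous_on S (\<lambda>x. norm (h x) powr p)" for S
    using continuous_on_norm_powr[OF continuous_on_subset[OF assms(2)] \<open>0 < p\<close>] by simp
  have "integrable lborel (\<lambda>x. indicator K x *\<^sub>R norm (h x) powr p)"
    by (rule borel_integrable_compact[OF \<open>compact K\<close> cont])
  moreover have "(\<lambda>x. indicator K x *\<^sub>R norm (h x) powr p) = (\<lambda>x. norm (h x) powr p)"
  proof
    show "indicator K x *\<^sub>R norm (h x) powr p = norm (h x) powr p" for x
      using assms(4)[of x] by (cases "x \<in> K") auto
  qed
  ultimately show int: "integrable lborel (\<lambda>x. norm (h x) powr p)" by metis
  have meas: "(\<lambda>x. norm (h x) powr p) \<in> borel_measurable lborel"
    using cont by (simp add: borel_measurable_continuous_onI)
  then have int': "integrable lebesgue (\<lambda>x. norm (h x) powr p)"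
    using int by (simp add: integrable_completion)
  then have "integrable (lebesgue_on \<Omega>) (\<lambda>x. norm (h x) powr p)"
    using integrable_mult_indicator[OF _ int', of \<Omega>] \<Omega> by (simp add: integrable_restrict_space)
  moreover have "h \<in> borel_measurable (lebesgue_on \<Omega>)"
    using continuous_imp_measurable_on_sets_lebesgue[OF continuous_on_subset[OF assms(2)] \<Omega>] by simp
  ultimately show "h \<in> Lp \<Omega> p" by (simp add: Lp_def)
  assume "K \<subseteq> \<Omega>"
  then have "norm (h x) powr p = 0" if "x \<notin> \<Omega>" for x
    using that assms(4)[of x] by auto
  then have "Lp_integral \<Omega> p h = (\<integral>x. norm (h x) powr p \<partial>lebesgue)"
    unfolding Lp_integral_def by (rule integral_lebesgue_on_supported[OF \<Omega>])
  also have "\<dots> = (\<integral>x. norm (h x) powr p \<partial>lborel)"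
    by (rule integral_completion[OF meas])
  finally show "Lp_integral \<Omega> p h = (\<integral>x. norm (h x) powr p \<partial>lborel)" .
qed

lemma norm_partial_derivative_le_classical_gradient:
  "norm (partial_derivative i \<phi> x) \<le> norm (classical_gradient \<phi> x)"
proof -
  have "\<bar>partial_derivative i \<phi> x $ j\<bar> \<le> norm (classical_gradient \<phi> x $ j)" for j
    using component_le_norm_cart[of "classical_gradient \<phi> x $ j" i] by (simp add: classical_gradient_def)
  then show ?thesis
    unfolding norm_vec_def by (intro L2_set_mono) (auto simp: norm_vec_def)
qed

lemma classical_gradient_outside_support:
  "x \<notin> closure {x. \<phi> x \<noteq> 0} \<Longrightarrow> classical_gradient \<phi> x = 0"
  by (simp add: classical_gradient_def vec_eq_iff partial_derivative_outside_support)

lemma test_function_Lp: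
  fixes \<phi> :: "real^'n \<Rightarrow> real^'d"
  assumes "open \<Omega>" "\<phi> \<in> test_functions \<Omega>" "0 < p"
  shows "\<phi> \<in> Lp \<Omega> p" "classical_gradient \<phi> \<in> Lp \<Omega> p"
    "integrable lborel (\<lambda>x. norm (\<phi> x) powr p)" 
    "integrable lborel (\<lambda>x. norm (classical_gradient \<phi> x) powr p)" 
    "Lp_integral \<Omega> p \<phi> = (\<integral>x. norm (\<phi> x) powr p \<partial>lborel)"
    "Lp_integral \<Omega> p (classical_gradient \<phi>) = (\<integral>x. norm (classical_gradient \<phi> x) powr p \<partial>lborel)"
proof -
  note D = test_functionsD[OF assms(2)]
  note * = compact_support_imp_Lp[OF assms(1) D(3) D(1) D(6) assms(3)]
  note ** = compact_support_imp_Lp[OF assms(1) continuous_classical_gradient[OF assms(2)] D(1)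
      classical_gradient_outside_support assms(3)]
  show "\<phi> \<in> Lp \<Omega> p" "classical_gradient \<phi> \<in> Lp \<Omega> p"
    "integrable lborel (\<lambda>x. norm (\<phi> x) powr p)" 
    "integrable lborel (\<lambda>x. norm (classical_gradient \<phi> x) powr p)" 
    using *(2) **(2) *(1) **(1) by blast+
  show "Lp_integral \<Omega> p \<phi> = (\<integral>x. norm (\<phi> x) powr p \<partial>lborel)"
    by (rule *(3)[OF _ D(2)])
  show "Lp_integral \<Omega> p (classical_gradient \<phi>) = (\<integral>x. norm (classical_gradient \<phi> x) powr p \<partial>lborel)"
    by (rule **(3)[OF _ D(2)])
qed

text \<open>
  The function \<open>g = x\<^sub>i |\<phi>|\<^sup>p\<close> satisfies \<open>\<partial>\<^sub>i g = |\<phi>|\<^sup>p + p x\<^sub>i |\<phi>|\<^sup>p\<^sup>-\<^sup>2 \<phi> \<bullet> \<partial>\<^sub>i \<phi>\<close> and has compact support, so the integral of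
  \<open>\<partial>\<^sub>i g\<close> vanishes. On the support \<open>|x\<^sub>i| \<le> R\<close>, and Young's inequality bounds the second summand by
  \<open>|\<phi>|\<^sup>p / 2\<close> plus a multiple of \<open>|\<partial>\<^sub>i \<phi>|\<^sup>p\<close>.
\<close>

lemma poincare_test_functions:
  fixes \<phi> :: "real^'n \<Rightarrow> real^'d"
  assumes "open \<Omega>" "\<Omega> \<subseteq> cball 0 R" "0 \<le> R" "1 < p" "\<phi> \<in> test_functions \<Omega>"
  shows "Lp_integral \<Omega> p \<phi> \<le> 2 * (p * R) * (2 * (p * R)) powr (p - 1) * Lp_integral \<Omega> p (classical_gradient \<phi>)"
proof -
  obtain i :: 'n where True by simp
  let ?d = "partial_derivative i \<phi>"
  let ?D = "\<lambda>x. p * norm (\<phi> x) powr (p - 2) * (\<phi> x \<bullet> ?d x)"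
  let ?g' = "\<lambda>x. norm (\<phi> x) powr p + x $ i * ?D x"
  let ?C = "p * R * (2 * (p * R)) powr (p - 1)"
  note D\<phi> = test_functionsD[OF assms(5)]
  note Lp = test_function_Lp[OF assms(1,5) order.strict_trans[OF zero_less_one assms(4)]]
  obtain B where B: "\<And>x. norm (\<phi> x) \<le> B" "\<And>x. norm (?d x) \<le> B"
    using test_function_bounded[OF assms(5), where i=i] by blast
  have "0 \<le> B" using B(1) norm_ge_zero order_trans by blast
  have inside: "norm x \<le> R" if "\<phi> x \<noteq> 0" for x
  proof -
    have "x \<in> closure {x. \<phi> x \<noteq> 0}" using that D\<phi>(6) by blast
    then have "x \<in> cball 0 R" using D\<phi>(2) assms(2) by blast
    then show ?thesis by simp
  qed
  have D_bound: "\<bar>x $ i * ?D x\<bar> \<le> p * R * norm (\<phi> x) powr (p - 1) * norm (?d x)" for x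
  proof (cases "\<phi> x = 0")
    case False
    have "\<bar>x $ i\<bar> \<le> R" using inside[OF False] component_le_norm_cart[of x i] by linarith
    moreover have "\<bar>?D x\<bar> \<le> p * norm (\<phi> x) powr (p - 1) * norm (?d x)"
    proof -
      have "\<bar>?D x\<bar> \<le> p * norm (\<phi> x) powr (p - 2) * (norm (\<phi> x) * norm (?d x))"
        using assms(4) Cauchy_Schwarz_ineq2[of "\<phi> x" "?d x"] by (auto simp: abs_mult intro!: mult_left_mono)
      also have "\<dots> = p * (norm (\<phi> x) * norm (\<phi> x) powr (p - 2)) * norm (?d x)" by simp
      also have "\<dots> = p * norm (\<phi> x) powr (p - 1) * norm (?d x)"
        by (simp add: powr_mult_base)
      finally show ?thesis .
    qed
    ultimately have "\<bar>x $ i\<bar> * \<bar>?D x\<bar> \<le> R * (p * norm (\<phi> x) powr (p - 1) * norm (?d x))"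
      using assms(3) by (intro mult_mono) auto
    then show ?thesis by (simp add: abs_mult mult_ac)
  qed simp
  obtain R' where R': "\<And>x. R' < norm x \<Longrightarrow> \<phi> x = 0"
    using test_function_vanishes_far[OF assms(5)] by blast
  have "has_bochner_integral lborel ?g' 0"
  proof (rule has_bochner_integral_directional_derivative)
    show "continuous_on UNIV (\<lambda>x. x $ i * norm (\<phi> x) powr p)"
      using assms(4)
      by (intro continuous_on_mult continuous_on_norm_powr[OF D\<phi>(3)] continuous_on_component continuous_on_id) auto
    show "x $ i * norm (\<phi> x) powr p = 0" if "R' < norm x" for x
      using R'[OF that] by simp
    show "((\<lambda>t. (x + t *\<^sub>R axis i 1) $ i * norm (\<phi> (x + t *\<^sub>R axis i 1)) powr p)
        has_real_derivative ?g' x) (at 0)" for x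
    proof -
      have 1: "((\<lambda>t. norm (\<phi> (x + t *\<^sub>R axis i 1)) powr p) has_real_derivative ?D x) (at 0)"
        using has_real_derivative_norm_powr[OF differentiable_imp_partial_derivative[OF D\<phi>(4)] assms(4), of x i]
        by simp
      have 2: "((\<lambda>t. (x + t *\<^sub>R axis i 1) $ i) has_real_derivative 1) (at 0)"
        by (auto intro!: derivative_eq_intros)
      show ?thesis
        by (rule DERIV_cong[OF DERIV_mult[OF 2 1]]) simp
    qed
    show "\<bar>?g' x\<bar> \<le> B powr p + p * R * B powr (p - 1) * B" for x
    proof -
      have "norm (\<phi> x) powr p \<le> B powr p"
        using B(1) assms(4) by (intro powr_mono2) auto
      moreover have "p * R * norm (\<phi> x) powr (p - 1) * norm (?d x) \<le> p * R * B powr (p - 1) * B"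
        using B assms(3,4) \<open>0 \<le> B\<close> by (intro mult_mono mult_left_mono powr_mono2) auto
      ultimately show ?thesis
        using D_bound[of x] by (intro order_trans[OF abs_triangle_ineq]) simp
    qed
  qed
  then have g': "integrable lborel ?g'" "integral\<^sup>L lborel ?g' = 0"
    by (simp_all only: has_bochner_integral_iff)
  have "norm (\<phi> x) powr p \<le> 2 * ?g' x + 2 * ?C * norm (classical_gradient \<phi> x) powr p" for x
  proof -
    have "norm (\<phi> x) powr p = ?g' x - x $ i * ?D x" by simp
    also have "\<dots> \<le> ?g' x + p * R * norm (\<phi> x) powr (p - 1) * norm (?d x)"
      using D_bound[of x] by linarith
    also have "p * R * norm (\<phi> x) powr (p - 1) * norm (?d x)
        \<le> norm (\<phi> x) powr p / 2 + ?C * norm (?d x) powr p"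
      using young_absorption[of "norm (\<phi> x)" "norm (?d x)" "p * R" p] assms(3,4) by simp
    also have "?C * norm (?d x) powr p \<le> ?C * norm (classical_gradient \<phi> x) powr p"
      using assms(3,4) norm_partial_derivative_le_classical_gradient[of i \<phi> x]
      by (intro mult_left_mono powr_mono2) auto
    finally show ?thesis by (simp add: algebra_simps)
  qed
  note * = this
  have int: "integrable lborel (\<lambda>x. 2 * ?g' x)"
    "integrable lborel (\<lambda>x. 2 * ?C * norm (classical_gradient \<phi> x) powr p)"
    by (rule integrable_mult_right[OF g'(1)], rule integrable_mult_right[OF Lp(4)])
  have "(\<integral>x. norm (\<phi> x) powr p \<partial>lborel) \<le>
      (\<integral>x. 2 * ?g' x + 2 * ?C * norm (classical_gradient \<phi> x) powr p \<partial>lborel)"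
    by (rule integral_mono[OF Lp(3) Bochner_Integration.integrable_add[OF int] *])
  also have "\<dots> = 2 * integral\<^sup>L lborel ?g' + 2 * ?C * (\<integral>x. norm (classical_gradient \<phi> x) powr p \<partial>lborel)"
    unfolding Bochner_Integration.integral_add[OF int] integral_mult_right_zero ..
  finally show ?thesis
    using g'(2) Lp(5,6) by (simp add: mult_ac)
qed

lemma W1p_test_function:
  fixes \<phi> :: "real^'n \<Rightarrow> real^'d"
  assumes "open \<Omega>" "\<phi> \<in> test_functions \<Omega>" "0 < p"
  shows "\<phi> \<in> W1p \<Omega> p"
  using test_function_Lp[OF assms] has_weak_gradient_test_function[OF assms(1,2)] by (auto simp: W1p_def)

text \<open>
  The inequality is inherited from approximating test functions; the error \<open>\<epsilon> k\<close>, the \<open>p\<close>-th power of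
  the distance to \<open>w\<close>, tends to zero.
\<close>

lemma poincare_W1p_0:
  fixes \<Omega> :: "(real^'n) set"
  assumes "open \<Omega>" "bounded \<Omega>" "1 < p"
  obtains C where "0 \<le> C"
    "\<And>w :: real^'n \<Rightarrow> real^'d. w \<in> W1p_0 \<Omega> p \<Longrightarrow> Lp_integral \<Omega> p w \<le> C * Lp_integral \<Omega> p (weak_gradient \<Omega> w)"
proof -
  obtain R where R: "0 < R" "\<Omega> \<subseteq> cball 0 R"
    using assms(2) bounded_pos[of \<Omega>] by (auto simp: subset_iff)
  \<comment> \<open>The constant of the inequality for test functions.\<close>
  define K where "K = 2 * (p * R) * (2 * (p * R)) powr (p - 1)"
  define C where "C = 2 powr p * (K * 2 powr p)"
  have p: "0 < p" using assms(3) by simp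
  have K: "0 \<le> K" using R p by (simp add: K_def)
  have "Lp_integral \<Omega> p w \<le> C * Lp_integral \<Omega> p (weak_gradient \<Omega> w)"
    if w: "w \<in> W1p_0 \<Omega> p" for w :: "real^'n \<Rightarrow> real^'d"
  proof -
    obtain \<phi> where \<phi>: "\<And>k. \<phi> k \<in> test_functions \<Omega>"
      and lim: "(\<lambda>k::nat. W1p_norm \<Omega> p (\<lambda>x. \<phi> k x - w x)) \<longlonglongrightarrow> 0"
      using w by (auto simp: W1p_0_def)
    have wW: "w \<in> W1p \<Omega> p" using w by (simp add: W1p_0_def)
    define \<epsilon> where "\<epsilon> = (\<lambda>k. W1p_norm \<Omega> p (\<lambda>x. \<phi> k x - w x) powr p)"
    have "\<epsilon> \<longlonglongrightarrow> 0 powr p"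
      unfolding \<epsilon>_def using lim p by (intro tendsto_powr') (auto simp: W1p_norm_eq)
    then have \<epsilon>0: "\<epsilon> \<longlonglongrightarrow> 0" by simp
    have bound: "Lp_integral \<Omega> p w \<le>
        2 powr p * (K * (2 powr p * (Lp_integral \<Omega> p (weak_gradient \<Omega> w) + \<epsilon> k)) + \<epsilon> k)" for k
    proof -
      let ?r = "\<lambda>x. \<phi> k x - w x"
      let ?gw = "weak_gradient \<Omega> w" and ?gf = "weak_gradient \<Omega> (\<phi> k)"
      have \<phi>W: "\<phi> k \<in> W1p \<Omega> p" by (rule W1p_test_function[OF assms(1) \<phi> p])
      note diff = W1p_diff[OF assms(1) \<phi>W wW less_imp_le[OF p]]
      \<comment> \<open>One summand of \<open>\<epsilon> k\<close> controls the functions and the other one their gradients.\<close>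
      have "\<epsilon> k = Lp_integral \<Omega> p ?r + Lp_integral \<Omega> p (weak_gradient \<Omega> ?r)"
        using p by (simp add: \<epsilon>_def W1p_norm_eq powr_powr Lp_integral_nonneg)
      then have \<epsilon>: "Lp_integral \<Omega> p ?r \<le> \<epsilon> k" "Lp_integral \<Omega> p (\<lambda>x. ?gw x - ?gf x) \<le> \<epsilon> k"
        using Lp_integral_nonneg[of \<Omega> p ?r] Lp_integral_nonneg[of \<Omega> p "weak_gradient \<Omega> ?r"] diff(2)
          Lp_integral_minus_commute[of \<Omega> p ?gw ?gf] by linarith+
      have "Lp_integral \<Omega> p (classical_gradient (\<phi> k)) = Lp_integral \<Omega> p ?gf"
        using Lp_AE_cong(2)[OF test_function_Lp(2)[OF assms(1) \<phi> p]
            Lp_measurableD[OF W1p_weak_gradientD(2)[OF assms(1) \<phi>W]]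
            weak_gradient_AE(2)[OF assms(1) has_weak_gradient_test_function[OF assms(1) \<phi>]]] by simp
      also have "\<dots> \<le> 2 powr p * (Lp_integral \<Omega> p ?gw + \<epsilon> k)"
        using \<epsilon>(2) p
        by (intro order_trans[OF Lp_integral_le_diff[OF W1p_weak_gradientD(2)[OF assms(1) \<phi>W]
              W1p_weak_gradientD(2)[OF assms(1) wW]]]) auto
      finally have "K * Lp_integral \<Omega> p (classical_gradient (\<phi> k)) \<le> K * (2 powr p * (Lp_integral \<Omega> p ?gw + \<epsilon> k))"
        using K by (rule mult_left_mono)
      moreover have "Lp_integral \<Omega> p (\<phi> k) \<le> K * Lp_integral \<Omega> p (classical_gradient (\<phi> k))"
        unfolding K_def using poincare_test_functions[OF assms(1) R(2) less_imp_le[OF R(1)] assms(3) \<phi>] .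
      ultimately have "Lp_integral \<Omega> p (\<phi> k) + Lp_integral \<Omega> p ?r \<le> K * (2 powr p * (Lp_integral \<Omega> p ?gw + \<epsilon> k)) + \<epsilon> k"
        using \<epsilon>(1) by linarith
      then have "2 powr p * (Lp_integral \<Omega> p (\<phi> k) + Lp_integral \<Omega> p ?r)
          \<le> 2 powr p * (K * (2 powr p * (Lp_integral \<Omega> p ?gw + \<epsilon> k)) + \<epsilon> k)"
        by (rule mult_left_mono) simp
      moreover have "Lp_integral \<Omega> p w \<le> 2 powr p * (Lp_integral \<Omega> p (\<phi> k) + Lp_integral \<Omega> p ?r)"
        using Lp_integral_le_diff[of w \<Omega> p "\<phi> k"] wW \<phi>W p by (simp add: W1p_def)
      ultimately show ?thesis by linarith
    qed
    have "(\<lambda>k. 2 powr p * (K * (2 powr p * (Lp_integral \<Omega> p (weak_gradient \<Omega> w) + \<epsilon> k)) + \<epsilon> k))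
        \<longlonglongrightarrow> 2 powr p * (K * (2 powr p * (Lp_integral \<Omega> p (weak_gradient \<Omega> w) + 0)) + 0)"
      by (intro tendsto_intros \<epsilon>0)
    then have "Lp_integral \<Omega> p w \<le> 2 powr p * (K * (2 powr p * (Lp_integral \<Omega> p (weak_gradient \<Omega> w) + 0)) + 0)"
      by (rule LIMSEQ_le_const) (use bound in blast)
    then show ?thesis by (simp add: C_def mult_ac)
  qed
  moreover have "0 \<le> C" using K by (simp add: C_def)
  ultimately show thesis using that by blast
qed

section \<open>Coercivity\<close>

text \<open>
  For \<open>y \<ge> s\<close> with \<open>s\<^sup>q\<^sup>-\<^sup>p = \<delta>\<close> the first term on the right suffices; for \<open>y < s\<close> the constant \<open>K = s\<^sup>q\<close> does.
\<close>

lemma powr_le_absorb: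
  fixes p q \<delta> :: real
  assumes "0 < q" "q < p" "0 < \<delta>"
  obtains K where "0 \<le> K" "\<And>y. 0 \<le> y \<Longrightarrow> y powr q \<le> \<delta> * y powr p + K"
proof -
  \<comment> \<open>The unique solution of \<open>s powr (q - p) = \<delta>\<close>.\<close>
  define s where "s = \<delta> powr (1 / (q - p))"
  have s: "0 < s" using assms by (simp add: s_def)
  have s_powr: "s powr (q - p) = \<delta>" using assms by (simp add: s_def powr_powr)
  have "y powr q \<le> \<delta> * y powr p + s powr q" if "0 \<le> y" for y
  proof (cases "s \<le> y")
    case True
    have "y powr q = y powr (q - p) * y powr p"
      using True s by (simp flip: powr_add)
    also have "\<dots> \<le> s powr (q - p) * y powr p"
      using True s assms by (intro mult_right_mono powr_mono2') auto
    finally show ?thesis by (simp add: s_powr add_increasing2)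
  next
    case False
    then have "y powr q \<le> s powr q"
      using that assms by (intro powr_mono2) auto
    then show ?thesis using assms by (simp add: add_increasing)
  qed
  then show thesis using that[of "s powr q"] by auto
qed

text \<open>
  The positive and the negative part are compared separately by monotonicity of the nonnegative integral, which
  holds for measurable and non-measurable functions alike.
\<close>

lemma integral_le_extended_integral:
  assumes h: "integrable M h" and le: "\<And>x. x \<in> space M \<Longrightarrow> h x \<le> g x"
  shows "ereal (\<integral>x. h x \<partial>M) \<le> extended_integral M g"
proof -
  let ?P = "\<lambda>h. \<integral>\<^sup>+x. ennreal (h x) \<partial>M" and ?N = "\<lambda>h. \<integral>\<^sup>+x. ennreal (- h x) \<partial>M"
  have fin: "?P h \<noteq> \<infinity>" "?N h \<noteq> \<infinity>"
    using h by (auto simp: real_integrable_def)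
  have "ereal (\<integral>x. h x \<partial>M) = ereal (enn2real (?P h)) - ereal (enn2real (?N h))"
    using h by (simp add: real_lebesgue_integral_def)
  also have "\<dots> = enn2ereal (?P h) - enn2ereal (?N h)"
    using fin by (cases "?P h"; cases "?N h") auto
  also have "\<dots> \<le> extended_integral M g"
    unfolding extended_integral_def
    using le by (intro ereal_minus_mono) (auto simp flip: less_eq_ennreal.rep_eq intro!: nn_integral_mono ennreal_leI)
  finally show ?thesis .
qed

text \<open>
  Apply the Poincare inequality to \<open>v - u\<^sub>0\<close> and estimate its gradient by those of \<open>v\<close> and \<open>u\<^sub>0\<close>.
\<close>

lemma poincare_affine:
  fixes \<Omega> :: "(real^'n) set" and u\<^sub>0 :: "real^'n \<Rightarrow> real^'d"
  assumes "open \<Omega>" "bounded \<Omega>" "1 < p" "u\<^sub>0 \<in> W1p \<Omega> p"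
  obtains A B where "0 \<le> A" "0 \<le> B"
    "\<And>v. v \<in> affine_W1p_0 \<Omega> p u\<^sub>0 \<Longrightarrow> Lp_integral \<Omega> p v \<le> A + B * Lp_integral \<Omega> p (weak_gradient \<Omega> v)"
proof -
  have p: "0 \<le> p" using assms(3) by simp
  obtain C where C: "0 \<le> C" "\<And>w :: real^'n \<Rightarrow> real^'d. w \<in> W1p_0 \<Omega> p \<Longrightarrow>
      Lp_integral \<Omega> p w \<le> C * Lp_integral \<Omega> p (weak_gradient \<Omega> w)"
    using poincare_W1p_0[OF assms(1-3)] by blast
  let ?g0 = "weak_gradient \<Omega> u\<^sub>0"
  define A where "A = 2 powr p * (Lp_integral \<Omega> p u\<^sub>0 + C * (2 powr p * Lp_integral \<Omega> p ?g0))"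
  define B where "B = 2 powr p * (C * 2 powr p)"
  have "Lp_integral \<Omega> p v \<le> A + B * Lp_integral \<Omega> p (weak_gradient \<Omega> v)"
    if "v \<in> affine_W1p_0 \<Omega> p u\<^sub>0" for v
  proof -
    obtain w where w: "w \<in> W1p_0 \<Omega> p" and v: "v = (\<lambda>x. u\<^sub>0 x + w x)"
      using \<open>v \<in> _\<close> by (auto simp: affine_W1p_0_def)
    have wW: "w \<in> W1p \<Omega> p" using w by (simp add: W1p_0_def)
    have vW: "v \<in> W1p \<Omega> p"
      using W1p_add_scaleR(1)[OF assms(1,4) wW p, of 1] by (simp add: v)
    let ?gv = "weak_gradient \<Omega> v"
    have g: "?gv \<in> Lp \<Omega> p" "?g0 \<in> Lp \<Omega> p"
      using W1p_weak_gradientD(2)[OF assms(1)] vW assms(4) by blast+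
    have "(\<lambda>x. ?gv x + (- 1) *\<^sub>R ?g0 x) \<in> Lp \<Omega> p"
      using g p by (intro Lp_add Lp_scaleR)
    then have "Lp_integral \<Omega> p (\<lambda>x. ?gv x - ?g0 x) \<le> 2 powr p * (Lp_integral \<Omega> p ?gv + Lp_integral \<Omega> p ?g0)"
      using Lp_integral_le_diff[of "\<lambda>x. ?gv x - ?g0 x" \<Omega> p ?gv] g p by simp
    moreover have "Lp_integral \<Omega> p (weak_gradient \<Omega> w) = Lp_integral \<Omega> p (\<lambda>x. ?gv x - ?g0 x)"
      using W1p_diff(2)[OF assms(1) vW assms(4) p] by (simp add: v)
    ultimately have "C * Lp_integral \<Omega> p (weak_gradient \<Omega> w) \<le> C * (2 powr p * (Lp_integral \<Omega> p ?gv + Lp_integral \<Omega> p ?g0))"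
      using C(1) by (simp add: mult_left_mono)
    then have "Lp_integral \<Omega> p u\<^sub>0 + Lp_integral \<Omega> p w
        \<le> Lp_integral \<Omega> p u\<^sub>0 + C * (2 powr p * (Lp_integral \<Omega> p ?gv + Lp_integral \<Omega> p ?g0))"
      using C(2)[OF w] by linarith
    then have "2 powr p * (Lp_integral \<Omega> p u\<^sub>0 + Lp_integral \<Omega> p w)
        \<le> 2 powr p * (Lp_integral \<Omega> p u\<^sub>0 + C * (2 powr p * (Lp_integral \<Omega> p ?gv + Lp_integral \<Omega> p ?g0)))"
      by (rule mult_left_mono) simp
    moreover have "Lp_integral \<Omega> p v \<le> 2 powr p * (Lp_integral \<Omega> p u\<^sub>0 + Lp_integral \<Omega> p w)"
      unfolding v using assms(4) wW p by (intro Lp_add(2)) (auto simp: W1p_def)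
    ultimately show ?thesis
      by (simp add: A_def B_def algebra_simps)
  qed
  moreover have "0 \<le> A" "0 \<le> B" using C(1) by (simp_all add: A_def B_def Lp_integral_nonneg)
  ultimately show thesis using that by blast
qed

lemma Lp_powr_integral_bound:
  fixes v :: "real^'n \<Rightarrow> 'b::euclidean_space"
  assumes "open \<Omega>" "bounded \<Omega>" "v \<in> Lp \<Omega> p"
    and K: "\<And>y. 0 \<le> y \<Longrightarrow> y powr q \<le> \<delta> * y powr p + K"
  shows "integrable (lebesgue_on \<Omega>) (\<lambda>x. norm (v x) powr q)"
    and "Lp_integral \<Omega> q v \<le> \<delta> * Lp_integral \<Omega> p v + K * measure lebesgue \<Omega>"
proof -
  have \<Omega>: "\<Omega> \<in> lmeasurable" using assms(1,2) by (simp add: lmeasurable_open)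
  then interpret finite_measure "lebesgue_on \<Omega>" by (rule finite_measure_lebesgue_on)
  note [measurable] = Lp_measurableD[OF assms(3)]
  have dom: "integrable (lebesgue_on \<Omega>) (\<lambda>x. \<delta> * norm (v x) powr p + K)"
    using Lp_integrableD[OF assms(3)] by simp
  show *: "integrable (lebesgue_on \<Omega>) (\<lambda>x. norm (v x) powr q)"
    by (rule Bochner_Integration.integrable_bound[OF dom]) (auto intro!: AE_I2 order_trans[OF K abs_ge_self])
  have "Lp_integral \<Omega> q v \<le> (\<integral>x. \<delta> * norm (v x) powr p + K \<partial>lebesgue_on \<Omega>)"
    unfolding Lp_integral_def using * dom by (rule integral_mono) (simp add: K)
  also have "\<dots> = \<delta> * Lp_integral \<Omega> p v + K * measure lebesgue \<Omega>"
    using Lp_integrableD[OF assms(3)] \<Omega> by (simp add: Lp_integral_def measure_restrict_space fmeasurableD)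
  finally show "Lp_integral \<Omega> q v \<le> \<delta> * Lp_integral \<Omega> p v + K * measure lebesgue \<Omega>" .
qed

text \<open>
  The constant \<open>\<delta>\<close> is chosen such that the term of order \<open>q\<close> consumes at most half of \<open>c\<^sub>0\<close> times the gradient
  integral.
\<close>

lemma coercive:
  fixes \<Omega> :: "(real^'n) set" and u\<^sub>0 :: "real^'n \<Rightarrow> real^'d"
  assumes "open \<Omega>" "bounded \<Omega>" "1 < p" "u\<^sub>0 \<in> W1p \<Omega> p" "p_growth \<Omega> p f"
  obtains C where "\<And>v. v \<in> affine_W1p_0 \<Omega> p u\<^sub>0 \<Longrightarrow> variational_functional \<Omega> f v \<le> ereal M \<Longrightarrow> W1p_norm \<Omega> p v \<le> C"
proof -
  obtain q c\<^sub>0 c\<^sub>1 c\<^sub>2 where q: "1 \<le> q" "q < p" and c\<^sub>0: "0 < c\<^sub>0" and c\<^sub>2: "integrable (lebesgue_on \<Omega>) c\<^sub>2"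
    and growth: "\<And>x u \<xi>. x \<in> closure \<Omega> \<Longrightarrow> f (x, u, \<xi>) \<ge> c\<^sub>0 * norm \<xi> powr p + c\<^sub>1 * norm u powr q + c\<^sub>2 x"
    using assms(5) unfolding p_growth_def by blast
  obtain A B where A: "0 \<le> A" and B: "0 \<le> B"
    and poincare: "\<And>v. v \<in> affine_W1p_0 \<Omega> p u\<^sub>0 \<Longrightarrow>
      Lp_integral \<Omega> p v \<le> A + B * Lp_integral \<Omega> p (weak_gradient \<Omega> v)"
    using poincare_affine[OF assms(1-4)] by blast
  define \<delta> where "\<delta> = c\<^sub>0 / (2 * (\<bar>c\<^sub>1\<bar> + 1) * (B + 1))"
  have \<delta>: "0 < \<delta>" using c\<^sub>0 B by (simp add: \<delta>_def)
  have \<delta>B: "\<bar>c\<^sub>1\<bar> * (\<delta> * B) \<le> c\<^sub>0 / 2"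
  proof -
    have "\<bar>c\<^sub>1\<bar> * (\<delta> * B) \<le> (\<bar>c\<^sub>1\<bar> + 1) * (\<delta> * (B + 1))"
      using \<delta> B by (intro mult_mono) auto
    also have "\<dots> = c\<^sub>0 / 2"
    proof -
      have "a * (c\<^sub>0 / (2 * a * b) * b) = c\<^sub>0 / 2" if "a \<noteq> 0" "b \<noteq> 0" for a b
        using that by simp
      from this[of "\<bar>c\<^sub>1\<bar> + 1" "B + 1"] show ?thesis
        using B by (simp add: \<delta>_def)
    qed
    finally show ?thesis .
  qed
  obtain K where K: "0 \<le> K" "\<And>y. 0 \<le> y \<Longrightarrow> y powr q \<le> \<delta> * y powr p + K"
    using powr_le_absorb[of q p \<delta>] q \<delta> by auto
  \<comment> \<open>The bound for the gradient integral that remains after the absorption.\<close>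
  define E where "E = 2 / c\<^sub>0 * (M + \<bar>c\<^sub>1\<bar> * (\<delta> * A + K * measure lebesgue \<Omega>) - (\<integral>x. c\<^sub>2 x \<partial>lebesgue_on \<Omega>))"
  have "W1p_norm \<Omega> p v \<le> (A + B * E + E) powr (1 / p)"
    if v: "v \<in> affine_W1p_0 \<Omega> p u\<^sub>0" and F: "variational_functional \<Omega> f v \<le> ereal M" for v
  proof -
    let ?gv = "weak_gradient \<Omega> v"
    let ?D = "Lp_integral \<Omega> p ?gv"
    have vW: "v \<in> W1p \<Omega> p"
      using v W1p_add_scaleR(1)[OF assms(1,4), of _ 1] assms(3) by (auto simp: affine_W1p_0_def W1p_0_def)
    have gv: "?gv \<in> Lp \<Omega> p" by (rule W1p_weak_gradientD(2)[OF assms(1) vW])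
    have vp: "v \<in> Lp \<Omega> p" using vW by (simp add: W1p_def)
    note vq = Lp_powr_integral_bound[OF assms(1,2) vp K(2)]
    note int = Lp_integrableD[OF gv] vq(1) c\<^sub>2
    have "ereal (\<integral>x. c\<^sub>0 * norm (?gv x) powr p + c\<^sub>1 * norm (v x) powr q + c\<^sub>2 x \<partial>lebesgue_on \<Omega>)
        \<le> variational_functional \<Omega> f v"
      unfolding variational_functional_def
      using int growth closure_subset[of \<Omega>] by (intro integral_le_extended_integral) auto
    then have "ereal (\<integral>x. c\<^sub>0 * norm (?gv x) powr p + c\<^sub>1 * norm (v x) powr q + c\<^sub>2 x \<partial>lebesgue_on \<Omega>) \<le> ereal M"
      using F by (rule order_trans)
    then have "c\<^sub>0 * ?D + c\<^sub>1 * Lp_integral \<Omega> q v + (\<integral>x. c\<^sub>2 x \<partial>lebesgue_on \<Omega>) \<le> M"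
      using int by (simp add: Lp_integral_def)
    moreover have "- (c\<^sub>1 * Lp_integral \<Omega> q v) \<le> \<bar>c\<^sub>1\<bar> * Lp_integral \<Omega> q v"
      using Lp_integral_nonneg[of \<Omega> q v] by (metis abs_ge_minus_self minus_mult_left mult_right_mono)
    moreover have "\<bar>c\<^sub>1\<bar> * Lp_integral \<Omega> q v \<le> \<bar>c\<^sub>1\<bar> * (\<delta> * A + K * measure lebesgue \<Omega>) + c\<^sub>0 / 2 * ?D"
    proof -
      have "\<delta> * Lp_integral \<Omega> p v \<le> \<delta> * (A + B * ?D)"
        using poincare[OF v] \<delta> by (intro mult_left_mono) auto
      then have "Lp_integral \<Omega> q v \<le> (\<delta> * A + K * measure lebesgue \<Omega>) + \<delta> * B * ?D"
        using vq(2) by (simp add: algebra_simps)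
      then have "\<bar>c\<^sub>1\<bar> * Lp_integral \<Omega> q v \<le> \<bar>c\<^sub>1\<bar> * ((\<delta> * A + K * measure lebesgue \<Omega>) + \<delta> * B * ?D)"
        by (rule mult_left_mono) simp
      also have "\<dots> = \<bar>c\<^sub>1\<bar> * (\<delta> * A + K * measure lebesgue \<Omega>) + \<bar>c\<^sub>1\<bar> * (\<delta> * B) * ?D"
        by (simp add: algebra_simps)
      also have "\<bar>c\<^sub>1\<bar> * (\<delta> * B) * ?D \<le> c\<^sub>0 / 2 * ?D"
        using \<delta>B Lp_integral_nonneg by (rule mult_right_mono)
      finally show ?thesis by simp
    qed
    ultimately have "c\<^sub>0 / 2 * ?D \<le> M + \<bar>c\<^sub>1\<bar> * (\<delta> * A + K * measure lebesgue \<Omega>) - (\<integral>x. c\<^sub>2 x \<partial>lebesgue_on \<Omega>)"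
      by linarith
    then have D: "?D \<le> E"
      using c\<^sub>0 by (simp add: E_def field_simps)
    have "Lp_integral \<Omega> p v \<le> A + B * E"
      using poincare[OF v] mult_left_mono[OF D B] by linarith
    then show ?thesis
      unfolding W1p_norm_eq using D assms(3)
      by (intro powr_mono2) (auto simp: Lp_integral_nonneg)
  qed
  then show thesis using that by blast
qed

theorem theorem1p2:
  fixes \<Omega> :: "(real ^ 'n) set"
    and p :: real
    and u\<^sub>0 :: "real ^ 'n \<Rightarrow> real ^ 'd"
    and f :: "(real ^ 'n) \<times> (real ^ 'd) \<times> (real ^ 'n ^ 'd) \<Rightarrow> real"
    and u :: "nat \<Rightarrow> real ^ 'n \<Rightarrow> real ^ 'd"
  defines "F \<equiv> variational_functional \<Omega> f"
    and "W \<equiv> affine_W1p_0 \<Omega> p u\<^sub>0"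
  assumes "1 < p"
    and "open \<Omega>" and "connected \<Omega>" and "\<Omega> \<noteq> {}"
    and "bounded \<Omega>" and "lipschitz_boundary \<Omega>"
    and "u\<^sub>0 \<in> W1p \<Omega> p"
    and "continuous_on (closure \<Omega> \<times> UNIV) f"
    and "p_growth \<Omega> p f"
    and "\<exists>w \<in> W. F w < \<infinity>"
    and "\<forall>w \<in> W. F w > - \<infinity>"
    and "\<forall>k. u k \<in> W"
    and "(\<lambda>k. F (u k)) \<longlonglongrightarrow> (INF w \<in> W. F w)"
  shows "\<exists>C. \<forall>k. u k \<in> W1p \<Omega> p \<and> W1p_norm \<Omega> p (u k) \<le> C"
proof -
  have uW1p: "u k \<in> W1p \<Omega> p" for k
  proof -
    obtain w where "w \<in> W1p_0 \<Omega> p" "u k = (\<lambda>x. u\<^sub>0 x + w x)"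
      using \<open>\<forall>k. u k \<in> W\<close> by (force simp: W_def affine_W1p_0_def)
    then show ?thesis
      using W1p_add_scaleR(1)[OF \<open>open \<Omega>\<close> \<open>u\<^sub>0 \<in> W1p \<Omega> p\<close>, of w 1] \<open>1 < p\<close> by (simp add: W1p_0_def)
  qed
  obtain w where "w \<in> W" "F w < \<infinity>" using \<open>\<exists>w \<in> W. F w < \<infinity>\<close> by blast
  then have "(INF w \<in> W. F w) < \<infinity>"
    by (meson INF_lower le_less_trans)
  then obtain M where M: "(INF w \<in> W. F w) < ereal M"
    using ereal_dense2 by blast
  obtain C where C: "\<And>v. v \<in> W \<Longrightarrow> F v \<le> ereal M \<Longrightarrow> W1p_norm \<Omega> p v \<le> C"
    unfolding W_def F_def
    using coercive[OF \<open>open \<Omega>\<close> \<open>bounded \<Omega>\<close> \<open>1 < p\<close> \<open>u\<^sub>0 \<in> W1p \<Omega> p\<close> \<open>p_growth \<Omega> p f\<close>, of M] by blast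
  have "\<forall>\<^sub>F k in sequentially. F (u k) < ereal M"
    using order_tendstoD(2)[OF \<open>(\<lambda>k. F (u k)) \<longlonglongrightarrow> (INF w \<in> W. F w)\<close> M] .
  then obtain N where N: "\<And>k. N \<le> k \<Longrightarrow> F (u k) < ereal M"
    by (auto simp: eventually_sequentially)
  define S where "S = (\<Sum>k<N. W1p_norm \<Omega> p (u k))"
  have nonneg: "0 \<le> W1p_norm \<Omega> p v" for v :: "real ^ 'n \<Rightarrow> real ^ 'd" by (simp add: W1p_norm_def)
  have "W1p_norm \<Omega> p (u k) \<le> max C S" for k
  proof (cases "k < N")
    case True
    then have "W1p_norm \<Omega> p (u k) \<le> S"
      unfolding S_def by (intro member_le_sum) (auto simp: nonneg)
    then show ?thesis by simp
  next
    case False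
    then have "W1p_norm \<Omega> p (u k) \<le> C"
      using N \<open>\<forall>k. u k \<in> W\<close> by (intro C) (auto simp: less_imp_le)
    then show ?thesis by simp
  qed
  then show ?thesis using uW1p by blast
qed

end
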